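(* Let $\alpha$ be a simple permutation of length at least $4$. Then the class $\mathrm{Av}(\alpha)\odot\mathrm{Av}(\alpha)$ is not definable by an FO sentence in \textsf{TOTO}; that is, there is no first-order sentence $\varphi$ over the signature $\{<_1,<_2\}$ such that for every permutation $\pi$, $\pi\models\varphi$ if and only if $\pi\in\mathrm{Av}(\alpha)\odot\mathrm{Av}(\alpha)$.
   Context: A permutation $\pi$ of $[n]$ is identified with its diagram $S_\pi=\{(i,\pi_i)\}$ and viewed as the structure $(S_\pi,\prec_1,\prec_2)$, where $<_1,<_2$ are interpreted as the orders by $x$- and $y$-coordinate (\textsf{TOTO}: the theory stating both are linear orders). A permutation $\tau$ contains $\sigma$ if $S_\tau$ has a subset isomorphic to $S_\sigma$ (an isomorphism of point sets in general position is a bijection preserving relative order of $x$-coordinates and of $y$-coordinates); otherwise $\tau$ avoids $\sigma$, and $\mathrm{Av}(\sigma)$ is the class of permutations avoiding $\sigma$. The inflation $\sigma[\tau_1,\dots,\tau_m]$ of $\sigma$ of length $m$ is the permutation obtained by replacing each point $(i,\sigma_i)$ of $S_\sigma$ by a tiny copy of $S_{\tau_i}$; a permutation is simple if it cannot be obtained as an inflation of a strictly smaller permutation (by permutations that are not all of length one, i.e., it has no nontrivial interval). For classes $\mathcal C,\mathcal D$, $\mathcal C\odot\mathcal D$ is the set of permutations whose points can be colored red and blue so that the red points form a permutation in $\mathcal C$ and the blue points form a permutation in $\mathcal D$. *)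

theory Defs
  imports Main
begin

text \<open>
  A permutation \<open>\<pi>\<close> of \<open>{1..n}\<close> is given in one-line notation, as the list
  \<open>[\<pi>\<^sub>1, \<dots>, \<pi>\<^sub>n]\<close>. The empty permutation is included, so that a colour class of a
  merge may be empty.
\<close>

definition perm :: "nat list \<Rightarrow> bool" where
  "perm \<pi> \<longleftrightarrow> distinct \<pi> \<and> set \<pi> = {1..length \<pi>}"

definition diagram :: "nat list \<Rightarrow> (nat \<times> nat) set" where
  "diagram \<pi> = {(i, \<pi> ! (i - 1)) | i. i \<in> {1..length \<pi>}}"

definition iso_points :: "(nat \<times> nat) set \<Rightarrow> (nat \<times> nat) set \<Rightarrow> bool" where
  "iso_points A B \<longleftrightarrow> (\<exists>f. bij_betw f A B \<and>
     (\<forall>p\<in>A. \<forall>q\<in>A. (fst p < fst q \<longleftrightarrow> fst (f p) < fst (f q)) \<and>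
                  (snd p < snd q \<longleftrightarrow> snd (f p) < snd (f q))))"

definition contains :: "nat list \<Rightarrow> nat list \<Rightarrow> bool" where
  "contains \<tau> \<sigma> \<longleftrightarrow> (\<exists>S \<subseteq> diagram \<tau>. iso_points S (diagram \<sigma>))"

definition Av :: "nat list \<Rightarrow> nat list set" where
  "Av \<sigma> = {\<tau>. perm \<tau> \<and> \<not> contains \<tau> \<sigma>}"

definition perm_merge :: "nat list set \<Rightarrow> nat list set \<Rightarrow> nat list set" where
  "perm_merge C D = {\<pi>. perm \<pi> \<and>
     (\<exists>R B. R \<union> B = diagram \<pi> \<and> R \<inter> B = {} \<and>
        (\<exists>\<rho>\<in>C. iso_points R (diagram \<rho>)) \<and> (\<exists>\<beta>\<in>D. iso_points B (diagram \<beta>)))}"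

text \<open>
  In the inflation \<open>\<sigma>[\<tau>\<^sub>1, \<dots>, \<tau>\<^sub>m]\<close> the copy of \<open>\<tau>\<^sub>i\<close> lies to the right of all copies of
  \<open>\<tau>\<^sub>k\<close> with \<open>k < i\<close> (hence the concatenation), and above all copies of \<open>\<tau>\<^sub>k\<close> with
  \<open>\<sigma>\<^sub>k < \<sigma>\<^sub>i\<close> (hence the shift of its values by the total length of those).
\<close>

definition inflation :: "nat list \<Rightarrow> nat list list \<Rightarrow> nat list" where
  "inflation \<sigma> \<tau>s = concat (map
     (\<lambda>i. map (\<lambda>v. v + (\<Sum>k | k < length \<sigma> \<and> \<sigma> ! k < \<sigma> ! i. length (\<tau>s ! k))) (\<tau>s ! i))
     [0..<length \<sigma>])"

text \<open>
  The inflated permutation \<open>\<sigma>\<close> must have length at least 2, because every permutation is the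
  inflation of the one-point permutation by itself. Since the \<open>\<tau>\<^sub>i\<close> are nonempty,
  \<open>length \<sigma> < length \<alpha>\<close> says that they do not all have length one.
\<close>

definition simple_perm :: "nat list \<Rightarrow> bool" where
  "simple_perm \<alpha> \<longleftrightarrow> perm \<alpha> \<and>
     \<not> (\<exists>\<sigma> \<tau>s. perm \<sigma> \<and> 2 \<le> length \<sigma> \<and> length \<sigma> < length \<alpha> \<and>
          length \<tau>s = length \<sigma> \<and> (\<forall>\<tau>\<in>set \<tau>s. perm \<tau> \<and> \<tau> \<noteq> []) \<and>
          \<alpha> = inflation \<sigma> \<tau>s)"

text \<open>First-order formulas over the signature \<open>{<\<^sub>1, <\<^sub>2}\<close> with equality; variables are
  named by natural numbers.\<close>

datatype fo =
    FLess1 nat nat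
  | FLess2 nat nat
  | FEq nat nat
  | FNot fo
  | FAnd fo fo
  | FEx nat fo

fun fv :: "fo \<Rightarrow> nat set" where
  "fv (FLess1 x y) = {x, y}"
| "fv (FLess2 x y) = {x, y}"
| "fv (FEq x y) = {x, y}"
| "fv (FNot \<phi>) = fv \<phi>"
| "fv (FAnd \<phi> \<psi>) = fv \<phi> \<union> fv \<psi>"
| "fv (FEx x \<phi>) = fv \<phi> - {x}"

definition sentence :: "fo \<Rightarrow> bool" where
  "sentence \<phi> \<longleftrightarrow> fv \<phi> = {}"

fun sat :: "'a set \<Rightarrow> ('a \<Rightarrow> 'a \<Rightarrow> bool) \<Rightarrow> ('a \<Rightarrow> 'a \<Rightarrow> bool) \<Rightarrow> (nat \<Rightarrow> 'a) \<Rightarrow> fo \<Rightarrow> bool" where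
  "sat U L1 L2 e (FLess1 x y) \<longleftrightarrow> L1 (e x) (e y)"
| "sat U L1 L2 e (FLess2 x y) \<longleftrightarrow> L2 (e x) (e y)"
| "sat U L1 L2 e (FEq x y) \<longleftrightarrow> e x = e y"
| "sat U L1 L2 e (FNot \<phi>) \<longleftrightarrow> \<not> sat U L1 L2 e \<phi>"
| "sat U L1 L2 e (FAnd \<phi> \<psi>) \<longleftrightarrow> sat U L1 L2 e \<phi> \<and> sat U L1 L2 e \<psi>"
| "sat U L1 L2 e (FEx x \<phi>) \<longleftrightarrow> (\<exists>a\<in>U. sat U L1 L2 (e(x := a)) \<phi>)"

lemma sat_cong_fv:
  "(\<And>x. x \<in> fv \<phi> \<Longrightarrow> e x = e' x) \<Longrightarrow> sat U L1 L2 e \<phi> \<longleftrightarrow> sat U L1 L2 e' \<phi>"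
proof (induction \<phi> arbitrary: e e')
  case (FNot \<phi>)
  show ?case using FNot.IH[of e e'] FNot.prems by simp
next
  case (FAnd \<phi> \<psi>)
  show ?case using FAnd.IH(1)[of e e'] FAnd.IH(2)[of e e'] FAnd.prems by simp
next
  case (FEx x \<phi>)
  have "sat U L1 L2 (e(x := a)) \<phi> \<longleftrightarrow> sat U L1 L2 (e'(x := a)) \<phi>" for a
    by (rule FEx.IH) (use FEx.prems in auto)
  then show ?case by simp
qed auto

text \<open>
  The assignment ranges over all points of the ambient type rather than over \<open>diagram \<pi>\<close>, which
  may be empty; for sentences it is irrelevant.
\<close>

definition models :: "nat list \<Rightarrow> fo \<Rightarrow> bool" where
  "models \<pi> \<phi> \<longleftrightarrow>
     (\<forall>e. sat (diagram \<pi>) (\<lambda>p q. fst p < fst q) (\<lambda>p q. snd p < snd q) e \<phi>)"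

lemma models_sentence:
  assumes "sentence \<phi>"
  shows "models \<pi> \<phi> \<longleftrightarrow>
    sat (diagram \<pi>) (\<lambda>p q. fst p < fst q) (\<lambda>p q. snd p < snd q) e \<phi>"
  using sat_cong_fv[of \<phi>] assms unfolding models_def sentence_def by blast

definition fo_definable_TOTO :: "nat list set \<Rightarrow> bool" where
  "fo_definable_TOTO C \<longleftrightarrow>
     (\<exists>\<phi>. sentence \<phi> \<and> (\<forall>\<pi>. perm \<pi> \<longrightarrow> (models \<pi> \<phi> \<longleftrightarrow> \<pi> \<in> C)))"

end

theory Submission
  imports Defs "HOL-Library.Product_Lexorder"
begin

text \<open>
  Inflate some points of a permutation by copies of \<open>\<alpha>\<close>. In a valid colouring each inflated
  point carries both colours, and since \<open>\<alpha>\<close> is simple, every other copy of \<open>\<alpha>\<close> meets each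
  inflated point at most once. So a copy of \<open>\<alpha>\<close> all of whose points but two are inflated forces
  these two to have different colours. Chaining such copies along a diagonal, the topmost point of
  one being the leftmost point of the next, gives points \<open>x\<^sub>0, \<dots>, x\<^sub>n\<close> of alternating colours; one
  more point in the lower right corner, forced to differ from both \<open>x\<^sub>0\<close> and \<open>x\<^sub>n\<close>, closes an
  odd or even cycle. The permutation is then colourable iff \<open>n\<close> is even, whereas a sentence cannot
  distinguish \<open>n\<close> from \<open>n + 1\<close> when \<open>n\<close> is large.

  No unintended copy of \<open>\<alpha>\<close> is monochromatic, provided that deleting a point of \<open>\<alpha>\<close> never leaves
  a sum-decomposable permutation. If this fails both for \<open>\<alpha>\<close> and for its reverse, then, up to
  symmetry, \<open>\<alpha>\<close> starts with some point followed by its maximum, and ends with its second largest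
  value; for these \<open>\<alpha>\<close> a variant of the chain works, where the rightmost point of one copy is the
  bottommost point of the next.
\<close>

section \<open>Permutations as point sets\<close>

text \<open>Where the condition on sums comes from: for even \<open>n\<close> the links are coloured
  by parity, so a monochromatic copy of the pattern through \<open>Link i\<close> avoids the two
  neighbouring links, and without its point at \<open>Link i\<close> it splits along the diagonal
  into points of smaller and of larger index. If no deletion of a point leaves such a split, the
  other points lie in a single block, which is too small for them.

  If deleting some point leaves a sum and deleting another leaves a skew sum, the two decompositions
  interact strongly, since an increasing pair never straddles a skew sum. This forces the
  exceptional shape. For it the topmost points of the first and last copies stay uninflated as well.
  They make the extra point agree with both end links, where the first chain makes it differ from
  both; in either case the end links agree, so the parity obstruction is the same.

  The length \<open>n\<close> enters only through the order of the indices, so inserting one index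
  far from all points named so far is invisible to a formula, for a distance that doubles at each
  quantifier.\<close>

definition embeds ::
  "'a set \<Rightarrow> ('a \<Rightarrow> int) \<Rightarrow> ('a \<Rightarrow> int) \<Rightarrow> 'p set \<Rightarrow> ('p \<Rightarrow> 'k::linorder) \<Rightarrow> ('p \<Rightarrow> 'k) \<Rightarrow> ('a \<Rightarrow> 'p) \<Rightarrow> bool"
where
  "embeds A r1 r2 U k1 k2 f \<longleftrightarrow> f ` A \<subseteq> U \<and>
     (\<forall>a\<in>A. \<forall>b\<in>A. (r1 a < r1 b \<longleftrightarrow> k1 (f a) < k1 (f b)) \<and> (r2 a < r2 b \<longleftrightarrow> k2 (f a) < k2 (f b)))"

text \<open>Ranks of the pattern are integers so that reversal is negation; keys may lie in any
  linear order, because those of the chain are lexicographic.\<close>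

definition two_colourable ::
  "'a set \<Rightarrow> ('a \<Rightarrow> int) \<Rightarrow> ('a \<Rightarrow> int) \<Rightarrow> 'p set \<Rightarrow> ('p \<Rightarrow> 'k::linorder) \<Rightarrow> ('p \<Rightarrow> 'k) \<Rightarrow> bool"
where
  "two_colourable A r1 r2 U k1 k2 \<longleftrightarrow>
     (\<exists>c :: 'p \<Rightarrow> bool. \<forall>f. embeds A r1 r2 U k1 k2 f \<longrightarrow> (\<exists>a\<in>A. \<exists>b\<in>A. c (f a) \<noteq> c (f b)))"

definition order_iso ::
  "'p set \<Rightarrow> ('p \<Rightarrow> 'k::linorder) \<Rightarrow> ('p \<Rightarrow> 'k) \<Rightarrow> 'q set \<Rightarrow> ('q \<Rightarrow> 'l::linorder) \<Rightarrow> ('q \<Rightarrow> 'l) \<Rightarrow> ('p \<Rightarrow> 'q) \<Rightarrow> bool"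
where
  "order_iso U k1 k2 V l1 l2 g \<longleftrightarrow> bij_betw g U V \<and>
     (\<forall>p\<in>U. \<forall>q\<in>U. (k1 p < k1 q \<longleftrightarrow> l1 (g p) < l1 (g q)) \<and> (k2 p < k2 q \<longleftrightarrow> l2 (g p) < l2 (g q)))"

section \<open>Transport along order isomorphisms\<close>

lemma order_iso_inv:
  assumes "order_iso U k1 k2 V l1 l2 g"
  shows "order_iso V l1 l2 U k1 k2 (inv_into U g)"
proof -
  have b: "bij_betw g U V" using assms by (simp add: order_iso_def)
  then have "inv_into U g p \<in> U \<and> g (inv_into U g p) = p" if "p \<in> V" for p
    using that by (metis bij_betw_imp_surj_on f_inv_into_f inv_into_into)
  then show ?thesis
    using assms bij_betw_inv_into[OF b] unfolding order_iso_def by metis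
qed

lemma embeds_order_iso:
  assumes "embeds A r1 r2 U k1 k2 f" and "order_iso U k1 k2 V l1 l2 g"
  shows "embeds A r1 r2 V l1 l2 (g \<circ> f)"
  using assms unfolding embeds_def order_iso_def bij_betw_def
  by (auto simp: image_subset_iff)

lemma two_colourable_order_iso_imp:
  assumes "order_iso U k1 k2 V l1 l2 g" and "two_colourable A r1 r2 U k1 k2"
  shows "two_colourable A r1 r2 V l1 l2"
proof -
  obtain c where c: "\<And>f. embeds A r1 r2 U k1 k2 f \<Longrightarrow> \<exists>a\<in>A. \<exists>b\<in>A. (c (f a) :: bool) \<noteq> c (f b)"
    using assms(2) unfolding two_colourable_def by blast
  show ?thesis
    unfolding two_colourable_def
  proof (intro exI allI impI)
    fix f assume "embeds A r1 r2 V l1 l2 f"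
    from c[OF embeds_order_iso[OF this order_iso_inv[OF assms(1)]]]
    show "\<exists>a\<in>A. \<exists>b\<in>A. (c \<circ> inv_into U g) (f a) \<noteq> (c \<circ> inv_into U g) (f b)" by simp
  qed
qed

lemma two_colourable_order_iso:
  assumes "order_iso U k1 k2 V l1 l2 g"
  shows "two_colourable A r1 r2 U k1 k2 \<longleftrightarrow> two_colourable A r1 r2 V l1 l2"
  using two_colourable_order_iso_imp[OF assms] two_colourable_order_iso_imp[OF order_iso_inv[OF assms]]
  by blast

lemma sat_order_iso:
  assumes iso: "order_iso U k1 k2 V l1 l2 g"
  shows "(\<And>x. x \<in> fv \<phi> \<Longrightarrow> e x \<in> U) \<Longrightarrow>
    sat U (\<lambda>p q. k1 p < k1 q) (\<lambda>p q. k2 p < k2 q) e \<phi> \<longleftrightarrow>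
    sat V (\<lambda>p q. l1 p < l1 q) (\<lambda>p q. l2 p < l2 q) (g \<circ> e) \<phi>"
proof (induction \<phi> arbitrary: e)
  case (FEq x y)
  then show ?case using iso unfolding order_iso_def bij_betw_def inj_on_def by auto
next
  case (FEx x \<phi>)
  have V: "V = g ` U" using iso by (auto simp: order_iso_def bij_betw_def)
  have "sat U (\<lambda>p q. k1 p < k1 q) (\<lambda>p q. k2 p < k2 q) (e(x := a)) \<phi> \<longleftrightarrow>
    sat V (\<lambda>p q. l1 p < l1 q) (\<lambda>p q. l2 p < l2 q) ((g \<circ> e)(x := g a)) \<phi>" if "a \<in> U" for a
  proof -
    have "(e(x := a)) y \<in> U" if "y \<in> fv \<phi>" for y
      using that \<open>a \<in> U\<close> FEx.prems[of y] by auto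
    moreover have "(g \<circ> e)(x := g a) = g \<circ> e(x := a)" by (simp add: fun_upd_comp)
    ultimately show ?thesis by (simp only: FEx.IH)
  qed
  then show ?case unfolding sat.simps V by blast
qed (use iso in \<open>auto simp: order_iso_def\<close>)

lemma rank_bij_betw:
  fixes k :: "'p \<Rightarrow> 'k::linorder"
  assumes "finite U" "inj_on k U"
  shows "bij_betw (\<lambda>p. card {q\<in>U. k q \<le> k p}) U {1..card U}"
    and "\<And>p q. p \<in> U \<Longrightarrow> q \<in> U \<Longrightarrow>
      card {u\<in>U. k u \<le> k p} < card {u\<in>U. k u \<le> k q} \<longleftrightarrow> k p < k q"
proof -
  have mono: "card {u\<in>U. k u \<le> k p} < card {u\<in>U. k u \<le> k q}" if "p \<in> U" "q \<in> U" "k p < k q" for p q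
  proof (rule psubset_card_mono)
    have "q \<in> {u\<in>U. k u \<le> k q}" "q \<notin> {u\<in>U. k u \<le> k p}" using that by auto
    then show "{u\<in>U. k u \<le> k p} \<subset> {u\<in>U. k u \<le> k q}" using that(3) by auto
  qed (use assms(1) in simp)
  have mono': "card {u\<in>U. k u \<le> k p} \<le> card {u\<in>U. k u \<le> k q}" if "k p \<le> k q" for p q
    by (rule card_mono) (use that assms(1) in auto)
  show iff: "card {u\<in>U. k u \<le> k p} < card {u\<in>U. k u \<le> k q} \<longleftrightarrow> k p < k q"
    if "p \<in> U" "q \<in> U" for p q
    using mono[OF that] mono'[of q p] by (metis not_le)
  have inj: "inj_on (\<lambda>p. card {q\<in>U. k q \<le> k p}) U"
    using iff assms(2) by (smt (verit) inj_on_def less_irrefl not_less_iff_gr_or_eq)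
  have "(\<lambda>p. card {q\<in>U. k q \<le> k p}) ` U \<subseteq> {1..card U}"
  proof
    fix m assume "m \<in> (\<lambda>p. card {q\<in>U. k q \<le> k p}) ` U"
    then obtain p where p: "p \<in> U" "m = card {q\<in>U. k q \<le> k p}" by blast
    have "card {q\<in>U. k q \<le> k p} \<le> card U" by (rule card_mono) (use assms in auto)
    moreover have "{q\<in>U. k q \<le> k p} \<noteq> {}" using p by auto
    ultimately show "m \<in> {1..card U}" using p assms(1) by (auto simp: Suc_le_eq card_gt_0_iff)
  qed
  moreover have "card ((\<lambda>p. card {q\<in>U. k q \<le> k p}) ` U) = card {1..card U}"
    using card_image[OF inj] by simp
  ultimately have "(\<lambda>p. card {q\<in>U. k q \<le> k p}) ` U = {1..card U}"
    by (intro card_subset_eq) auto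
  with inj show "bij_betw (\<lambda>p. card {q\<in>U. k q \<le> k p}) U {1..card U}"
    by (simp add: bij_betw_def)
qed

text \<open>Replacing both keys by ranks yields a diagram, so the constructions below never have to
  name a permutation.\<close>

lemma standardisation:
  fixes k1 k2 :: "'p \<Rightarrow> 'k::linorder"
  assumes "finite U" "inj_on k1 U" "inj_on k2 U"
  obtains \<pi> g where "perm \<pi>" "order_iso U k1 k2 (diagram \<pi>) fst snd g"
proof -
  define R1 where "R1 = (\<lambda>p. card {q\<in>U. k1 q \<le> k1 p})"
  define R2 where "R2 = (\<lambda>p. card {q\<in>U. k2 q \<le> k2 p})"
  note b1 = rank_bij_betw[OF assms(1,2), folded R1_def]
  note b2 = rank_bij_betw[OF assms(1,3), folded R2_def]
  define J where "J = inv_into U R1"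
  have J: "bij_betw J {1..card U} U" unfolding J_def by (rule bij_betw_inv_into[OF b1(1)])
  have JR: "J (R1 p) = p" if "p \<in> U" for p
    using b1(1) that unfolding J_def bij_betw_def by (simp add: inv_into_f_f)
  define \<pi> where "\<pi> = map (\<lambda>i. R2 (J (Suc i))) [0..<card U]"
  have S: "bij_betw Suc {0..<card U} {1..card U}"
    by (rule bij_betwI'[where f = Suc]) (auto simp: Bex_def, metis Suc_pred' Suc_le_eq less_Suc_eq_le)
  have b: "bij_betw (\<lambda>i. R2 (J (Suc i))) {0..<card U} {1..card U}"
    using bij_betw_trans[OF bij_betw_trans[OF S J] b2(1)] by (simp add: comp_def)
  have len: "length \<pi> = card U" by (simp add: \<pi>_def)
  have perm: "perm \<pi>"
    using b by (auto simp: perm_def \<pi>_def distinct_map bij_betw_def)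
  let ?g = "\<lambda>p. (R1 p, R2 p)"
  have inj: "inj_on ?g U" using b1(1) by (auto simp: bij_betw_def inj_on_def)
  have nth: "\<pi> ! (i - 1) = R2 (J i)" if "i \<in> {1..card U}" for i
    using that by (cases i) (auto simp: \<pi>_def)
  have "diagram \<pi> = (\<lambda>i. (i, R2 (J i))) ` {1..card U}"
    unfolding diagram_def len using nth by (auto simp: image_iff)
  also have "\<dots> = (\<lambda>i. (i, R2 (J i))) ` R1 ` U"
    using b1(1) by (simp add: bij_betw_def)
  also have "\<dots> = ?g ` U" using JR by (auto simp: image_iff)
  finally have "diagram \<pi> = ?g ` U" .
  then have "order_iso U k1 k2 (diagram \<pi>) fst snd ?g"
    using inj b1(2) b2(2) unfolding order_iso_def bij_betw_def R1_def R2_def by simp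
  with perm show ?thesis by (rule that)
qed

section \<open>Merges of avoidance classes as two-colourings\<close>

lemma finite_diagram: "finite (diagram \<pi>)"
  by (simp add: diagram_def)

lemma inj_on_fst_diagram: "inj_on fst (diagram \<pi>)"
  by (auto simp: diagram_def inj_on_def)

lemma inj_on_snd_diagram:
  assumes "perm \<pi>"
  shows "inj_on snd (diagram \<pi>)"
proof (rule inj_onI)
  fix p q assume "p \<in> diagram \<pi>" "q \<in> diagram \<pi>" "snd p = snd q"
  then obtain i j where ij: "p = (i, \<pi> ! (i - 1))" "q = (j, \<pi> ! (j - 1))"
    "i \<in> {1..length \<pi>}" "j \<in> {1..length \<pi>}" "\<pi> ! (i - 1) = \<pi> ! (j - 1)"
    by (auto simp: diagram_def)
  then have "i - 1 = j - 1"
    using assms nth_eq_iff_index_eq[of \<pi> "i - 1" "j - 1"] by (auto simp: perm_def)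
  with ij show "p = q" by auto
qed

lemma card_diagram: "card (diagram \<pi>) = length \<pi>"
proof -
  have "diagram \<pi> = (\<lambda>i. (i, \<pi> ! (i - 1))) ` {1..length \<pi>}" by (auto simp: diagram_def)
  moreover have "inj_on (\<lambda>i. (i, \<pi> ! (i - 1))) {1..length \<pi>}" by (auto simp: inj_on_def)
  ultimately show ?thesis by (simp add: card_image)
qed

abbreviation pos_rank :: "nat \<times> nat \<Rightarrow> int" where "pos_rank p \<equiv> int (fst p)"
abbreviation val_rank :: "nat \<times> nat \<Rightarrow> int" where "val_rank p \<equiv> int (snd p)"

lemma contains_iff_embeds:
  "contains \<tau> \<sigma> \<longleftrightarrow> (\<exists>f. embeds (diagram \<sigma>) pos_rank val_rank (diagram \<tau>) fst snd f)"
proof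
  assume "contains \<tau> \<sigma>"
  then obtain S g where S: "S \<subseteq> diagram \<tau>" and "order_iso S fst snd (diagram \<sigma>) fst snd g"
    unfolding contains_def iso_points_def order_iso_def by blast
  from order_iso_inv[OF this(2)] S
  have "embeds (diagram \<sigma>) pos_rank val_rank (diagram \<tau>) fst snd (inv_into S g)"
    by (auto simp: embeds_def order_iso_def bij_betw_def)
  then show "\<exists>f. embeds (diagram \<sigma>) pos_rank val_rank (diagram \<tau>) fst snd f" by blast
next
  assume "\<exists>f. embeds (diagram \<sigma>) pos_rank val_rank (diagram \<tau>) fst snd f"
  then obtain f where f: "embeds (diagram \<sigma>) pos_rank val_rank (diagram \<tau>) fst snd f" by blast
  have "inj_on f (diagram \<sigma>)"
  proof (rule inj_onI)
    fix p q assume pq: "p \<in> diagram \<sigma>" "q \<in> diagram \<sigma>" "f p = f q"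
    then have "\<not> fst p < fst q" "\<not> fst q < fst p" using f by (auto simp: embeds_def)
    then show "p = q" using pq inj_on_fst_diagram[of \<sigma>] by (auto simp: inj_on_def)
  qed
  then have "order_iso (diagram \<sigma>) fst snd (f ` diagram \<sigma>) fst snd f"
    using f by (auto simp: order_iso_def embeds_def inj_on_imp_bij_betw)
  from order_iso_inv[OF this] have "iso_points (f ` diagram \<sigma>) (diagram \<sigma>)"
    unfolding iso_points_def order_iso_def by blast
  then show "contains \<tau> \<sigma>" using f by (auto simp: contains_def embeds_def)
qed

text \<open>A colour class avoids the pattern exactly when no embedding lands inside it;
  standardisation turns each class into a permutation.\<close>

lemma perm_merge_iff_two_colourable:
  assumes "perm \<pi>"
  shows "\<pi> \<in> perm_merge (Av \<alpha>) (Av \<alpha>) \<longleftrightarrow>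
    two_colourable (diagram \<alpha>) pos_rank val_rank (diagram \<pi>) fst snd"
proof
  let ?e = "embeds (diagram \<alpha>) pos_rank val_rank"
  assume "\<pi> \<in> perm_merge (Av \<alpha>) (Av \<alpha>)"
  then obtain R B \<rho> \<beta> where RB: "R \<union> B = diagram \<pi>" "R \<inter> B = {}"
    and \<rho>: "\<not> contains \<rho> \<alpha>" "iso_points R (diagram \<rho>)"
    and \<beta>: "\<not> contains \<beta> \<alpha>" "iso_points B (diagram \<beta>)"
    unfolding perm_merge_def Av_def by blast
  have no: "\<not> ?e S fst snd f" if "\<not> contains \<gamma> \<alpha>" "iso_points S (diagram \<gamma>)" for \<gamma> S f
    using that embeds_order_iso[of "diagram \<alpha>" pos_rank val_rank S fst snd f]
    unfolding contains_iff_embeds iso_points_def order_iso_def by blast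
  have noR: "\<not> ?e R fst snd f" "\<not> ?e B fst snd f" for f using no \<rho> \<beta> by blast+
  show "two_colourable (diagram \<alpha>) pos_rank val_rank (diagram \<pi>) fst snd"
    unfolding two_colourable_def
  proof (intro exI[where x = "\<lambda>p. p \<in> R"] allI impI)
    fix f assume f: "?e (diagram \<pi>) fst snd f"
    show "\<exists>a\<in>diagram \<alpha>. \<exists>b\<in>diagram \<alpha>. (f a \<in> R) \<noteq> (f b \<in> R)"
    proof (rule ccontr)
      assume "\<not> ?thesis"
      then have "f ` diagram \<alpha> \<subseteq> R \<or> f ` diagram \<alpha> \<subseteq> B"
        using f RB unfolding embeds_def by blast
      then have "?e R fst snd f \<or> ?e B fst snd f" using f by (simp add: embeds_def)
      then show False using noR by blast
    qed
  qed
next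
  let ?e = "embeds (diagram \<alpha>) pos_rank val_rank"
  assume "two_colourable (diagram \<alpha>) pos_rank val_rank (diagram \<pi>) fst snd"
  then obtain c where c: "\<And>f. ?e (diagram \<pi>) fst snd f \<Longrightarrow>
      \<exists>a\<in>diagram \<alpha>. \<exists>b\<in>diagram \<alpha>. (c (f a) :: bool) \<noteq> c (f b)"
    unfolding two_colourable_def by blast
  have side: "\<exists>\<rho>\<in>Av \<alpha>. iso_points {p \<in> diagram \<pi>. c p = k} (diagram \<rho>)" for k
  proof -
    let ?R = "{p \<in> diagram \<pi>. c p = k}"
    have sub: "?R \<subseteq> diagram \<pi>" by blast
    obtain \<rho> g where \<rho>: "perm \<rho>" and g: "order_iso ?R fst snd (diagram \<rho>) fst snd g"
      by (rule standardisation[OF finite_subset[OF sub finite_diagram]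
        inj_on_subset[OF inj_on_fst_diagram sub] inj_on_subset[OF inj_on_snd_diagram[OF assms] sub]])
    have "\<not> contains \<rho> \<alpha>"
    proof
      assume "contains \<rho> \<alpha>"
      then obtain f where "?e (diagram \<rho>) fst snd f" unfolding contains_iff_embeds by blast
      from embeds_order_iso[OF this order_iso_inv[OF g]]
      obtain f' where f': "?e ?R fst snd f'" by blast
      then have "?e (diagram \<pi>) fst snd f'" by (auto simp: embeds_def)
      from c[OF this] f' show False by (auto simp: embeds_def)
    qed
    then show ?thesis using \<rho> g unfolding Av_def iso_points_def order_iso_def by blast
  qed
  have "{p \<in> diagram \<pi>. c p = True} \<union> {p \<in> diagram \<pi>. c p = False} = diagram \<pi>"
    "{p \<in> diagram \<pi>. c p = True} \<inter> {p \<in> diagram \<pi>. c p = False} = {}" by auto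
  then show "\<pi> \<in> perm_merge (Av \<alpha>) (Av \<alpha>)"
    unfolding perm_merge_def mem_Collect_eq using side[of True] side[of False] assms
    by (intro conjI exI[of _ "{p \<in> diagram \<pi>. c p = True}"] exI[of _ "{p \<in> diagram \<pi>. c p = False}"])
qed

text \<open>Formulated for a pattern with ranks instead of a permutation, so that it can be carried
  along symmetries of the pattern.\<close>

definition undefinable :: "'a set \<Rightarrow> ('a \<Rightarrow> int) \<Rightarrow> ('a \<Rightarrow> int) \<Rightarrow> bool" where
  "undefinable A r1 r2 \<longleftrightarrow> (\<forall>\<phi>. sentence \<phi> \<longrightarrow>
     (\<exists>\<pi> \<sigma>. perm \<pi> \<and> perm \<sigma> \<and> (models \<pi> \<phi> \<longleftrightarrow> models \<sigma> \<phi>) \<and>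
        two_colourable A r1 r2 (diagram \<pi>) fst snd \<and> \<not> two_colourable A r1 r2 (diagram \<sigma>) fst snd))"

lemma undefinable_imp_not_fo_definable:
  assumes "undefinable (diagram \<alpha>) pos_rank val_rank"
  shows "\<not> fo_definable_TOTO (perm_merge (Av \<alpha>) (Av \<alpha>))"
proof
  assume "fo_definable_TOTO (perm_merge (Av \<alpha>) (Av \<alpha>))"
  then obtain \<phi> where \<phi>: "sentence \<phi>"
    "\<And>\<pi>. perm \<pi> \<Longrightarrow> models \<pi> \<phi> \<longleftrightarrow> \<pi> \<in> perm_merge (Av \<alpha>) (Av \<alpha>)"
    unfolding fo_definable_TOTO_def by blast
  with assms obtain \<pi> \<sigma> where "perm \<pi>" "perm \<sigma>" "models \<pi> \<phi> \<longleftrightarrow> models \<sigma> \<phi>"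
    "two_colourable (diagram \<alpha>) pos_rank val_rank (diagram \<pi>) fst snd"
    "\<not> two_colourable (diagram \<alpha>) pos_rank val_rank (diagram \<sigma>) fst snd"
    unfolding undefinable_def by blast
  with \<phi>(2) show False by (simp add: perm_merge_iff_two_colourable)
qed

abbreviation sat_keys :: "'p set \<Rightarrow> ('p \<Rightarrow> 'k::linorder) \<Rightarrow> ('p \<Rightarrow> 'k) \<Rightarrow> (nat \<Rightarrow> 'p) \<Rightarrow> fo \<Rightarrow> bool" where
  "sat_keys U k1 k2 \<equiv> sat U (\<lambda>p q. k1 p < k1 q) (\<lambda>p q. k2 p < k2 q)"

lemma separation_by_perms:
  fixes k1 k2 :: "'p \<Rightarrow> 'k::linorder" and l1 l2 :: "'q \<Rightarrow> 'l::linorder"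
  assumes s: "sentence \<phi>"
    and U: "finite U" "inj_on k1 U" "inj_on k2 U"
    and V: "finite V" "inj_on l1 V" "inj_on l2 V"
    and agree: "sat_keys U k1 k2 e \<phi> \<longleftrightarrow> sat_keys V l1 l2 e' \<phi>"
    and col: "two_colourable A r1 r2 U k1 k2" "\<not> two_colourable A r1 r2 V l1 l2"
  shows "\<exists>\<pi> \<sigma>. perm \<pi> \<and> perm \<sigma> \<and> (models \<pi> \<phi> \<longleftrightarrow> models \<sigma> \<phi>) \<and>
    two_colourable A r1 r2 (diagram \<pi>) fst snd \<and> \<not> two_colourable A r1 r2 (diagram \<sigma>) fst snd"
proof -
  obtain \<pi> g where \<pi>: "perm \<pi>" "order_iso U k1 k2 (diagram \<pi>) fst snd g"
    using standardisation[OF U] by blast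
  obtain \<sigma> h where \<sigma>: "perm \<sigma>" "order_iso V l1 l2 (diagram \<sigma>) fst snd h"
    using standardisation[OF V] by blast
  have "models \<pi> \<phi> \<longleftrightarrow> sat_keys U k1 k2 e \<phi>"
    unfolding models_sentence[OF s, of \<pi> "g \<circ> e"]
    using sat_order_iso[OF \<pi>(2), of \<phi> e] s by (simp add: sentence_def)
  moreover have "models \<sigma> \<phi> \<longleftrightarrow> sat_keys V l1 l2 e' \<phi>"
    unfolding models_sentence[OF s, of \<sigma> "h \<circ> e'"]
    using sat_order_iso[OF \<sigma>(2), of \<phi> e'] s by (simp add: sentence_def)
  ultimately have "models \<pi> \<phi> \<longleftrightarrow> models \<sigma> \<phi>" using agree by blast
  moreover have "two_colourable A r1 r2 (diagram \<pi>) fst snd"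
    "\<not> two_colourable A r1 r2 (diagram \<sigma>) fst snd"
    using col two_colourable_order_iso[OF \<pi>(2), of A r1 r2]
      two_colourable_order_iso[OF \<sigma>(2), of A r1 r2] by blast+
  ultimately show ?thesis using \<pi>(1) \<sigma>(1) by blast
qed

section \<open>Symmetries: reversing the first order, swapping the two orders\<close>

primrec flip :: "fo \<Rightarrow> fo" where
  "flip (FLess1 x y) = FLess1 y x"
| "flip (FLess2 x y) = FLess2 x y"
| "flip (FEq x y) = FEq x y"
| "flip (FNot \<phi>) = FNot (flip \<phi>)"
| "flip (FAnd \<phi> \<psi>) = FAnd (flip \<phi>) (flip \<psi>)"
| "flip (FEx x \<phi>) = FEx x (flip \<phi>)"

primrec transp :: "fo \<Rightarrow> fo" where
  "transp (FLess1 x y) = FLess2 x y"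
| "transp (FLess2 x y) = FLess1 x y"
| "transp (FEq x y) = FEq x y"
| "transp (FNot \<phi>) = FNot (transp \<phi>)"
| "transp (FAnd \<phi> \<psi>) = FAnd (transp \<phi>) (transp \<psi>)"
| "transp (FEx x \<phi>) = FEx x (transp \<phi>)"

lemma sentence_flip: "sentence (flip \<phi>) \<longleftrightarrow> sentence \<phi>"
proof -
  have "fv (flip \<phi>) = fv \<phi>" by (induction \<phi>) auto
  then show ?thesis by (simp add: sentence_def)
qed

lemma sentence_transp: "sentence (transp \<phi>) \<longleftrightarrow> sentence \<phi>"
proof -
  have "fv (transp \<phi>) = fv \<phi>" by (induction \<phi>) auto
  then show ?thesis by (simp add: sentence_def)
qed

lemma sat_flip: "sat U L1 L2 e (flip \<phi>) \<longleftrightarrow> sat U (\<lambda>p q. L1 q p) L2 e \<phi>"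
  by (induction \<phi> arbitrary: e) auto

lemma sat_transp: "sat U L1 L2 e (transp \<phi>) \<longleftrightarrow> sat U L2 L1 e \<phi>"
  by (induction \<phi> arbitrary: e) auto

lemma two_colourable_flip:
  "two_colourable A (\<lambda>a. - r1 a) r2 U k1 k2 \<longleftrightarrow> two_colourable A r1 r2 U (\<lambda>p. - k1 p :: int) k2"
proof -
  have "embeds A (\<lambda>a. - r1 a) r2 U k1 k2 f \<longleftrightarrow> embeds A r1 r2 U (\<lambda>p. - k1 p) k2 f" for f
    unfolding embeds_def by auto
  then show ?thesis by (simp add: two_colourable_def)
qed

lemma two_colourable_transp:
  "two_colourable A r2 r1 U k2 k1 \<longleftrightarrow> two_colourable A r1 r2 U k1 k2"
proof -
  have "embeds A r2 r1 U k2 k1 f \<longleftrightarrow> embeds A r1 r2 U k1 k2 f" for f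
    unfolding embeds_def by blast
  then show ?thesis by (simp add: two_colourable_def)
qed

lemma two_colourable_int:
  "two_colourable A r1 r2 U (\<lambda>p. int (k1 p)) (\<lambda>p. int (k2 p)) \<longleftrightarrow> two_colourable A r1 r2 U k1 k2"
  by (simp add: two_colourable_def embeds_def)

text \<open>The hypothesis is applied to \<open>flip \<phi>\<close>: a diagram satisfies it iff the
  diagram with negated positions satisfies \<open>\<phi>\<close>, and negating the ranks of the
  pattern has the same effect on colourability as negating the positions.\<close>

lemma undefinable_flip:
  assumes "undefinable A (\<lambda>a. - r1 a) r2"
  shows "undefinable A r1 r2"
  unfolding undefinable_def
proof (intro allI impI)
  fix \<phi> assume s: "sentence \<phi>"
  then obtain \<pi> \<sigma> where p: "perm \<pi>" "perm \<sigma>" "models \<pi> (flip \<phi>) \<longleftrightarrow> models \<sigma> (flip \<phi>)"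
    "two_colourable A (\<lambda>a. - r1 a) r2 (diagram \<pi>) fst snd"
    "\<not> two_colourable A (\<lambda>a. - r1 a) r2 (diagram \<sigma>) fst snd"
    using assms sentence_flip unfolding undefinable_def by blast
  have models: "models \<tau> (flip \<phi>) \<longleftrightarrow>
      sat_keys (diagram \<tau>) (\<lambda>p. - pos_rank p) val_rank undefined \<phi>" for \<tau>
    unfolding models_sentence[OF iffD2[OF sentence_flip s], of \<tau> undefined] sat_flip by simp
  have col: "two_colourable A (\<lambda>a. - r1 a) r2 (diagram \<tau>) fst snd \<longleftrightarrow>
      two_colourable A r1 r2 (diagram \<tau>) (\<lambda>p. - pos_rank p) val_rank" for \<tau>
    unfolding two_colourable_flip[symmetric] two_colourable_int ..
  have inj: "inj_on (\<lambda>p. - pos_rank p) (diagram \<tau>)" "perm \<tau> \<Longrightarrow> inj_on val_rank (diagram \<tau>)" for \<tau>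
    using inj_on_fst_diagram[of \<tau>] inj_on_snd_diagram[of \<tau>] by (auto simp: inj_on_def)
  show "\<exists>\<pi> \<sigma>. perm \<pi> \<and> perm \<sigma> \<and> (models \<pi> \<phi> \<longleftrightarrow> models \<sigma> \<phi>) \<and>
    two_colourable A r1 r2 (diagram \<pi>) fst snd \<and> \<not> two_colourable A r1 r2 (diagram \<sigma>) fst snd"
    using p(3-5) unfolding models col
    by (rule separation_by_perms[OF s finite_diagram inj(1) inj(2)[OF p(1)]
        finite_diagram inj(1) inj(2)[OF p(2)]])
qed

lemma undefinable_transp:
  assumes "undefinable A r2 r1"
  shows "undefinable A r1 r2"
  unfolding undefinable_def
proof (intro allI impI)
  fix \<phi> assume s: "sentence \<phi>"
  then obtain \<pi> \<sigma> where p: "perm \<pi>" "perm \<sigma>" "models \<pi> (transp \<phi>) \<longleftrightarrow> models \<sigma> (transp \<phi>)"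
    "two_colourable A r2 r1 (diagram \<pi>) fst snd"
    "\<not> two_colourable A r2 r1 (diagram \<sigma>) fst snd"
    using assms sentence_transp unfolding undefinable_def by blast
  have models: "models \<tau> (transp \<phi>) \<longleftrightarrow> sat_keys (diagram \<tau>) snd fst undefined \<phi>" for \<tau>
    unfolding models_sentence[OF iffD2[OF sentence_transp s], of \<tau> undefined] sat_transp by simp
  show "\<exists>\<pi> \<sigma>. perm \<pi> \<and> perm \<sigma> \<and> (models \<pi> \<phi> \<longleftrightarrow> models \<sigma> \<phi>) \<and>
    two_colourable A r1 r2 (diagram \<pi>) fst snd \<and> \<not> two_colourable A r1 r2 (diagram \<sigma>) fst snd"
    using p(3-5) unfolding models two_colourable_transp[of A r2 r1 _ fst snd]
    by (rule separation_by_perms[OF s finite_diagram inj_on_snd_diagram[OF p(1)] inj_on_fst_diagram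
        finite_diagram inj_on_snd_diagram[OF p(2)] inj_on_fst_diagram])
qed

section \<open>Intervals of simple permutations\<close>

text \<open>The block \<open>m\<close> is contracted to the value \<open>c + 1\<close> and larger
  values drop by \<open>length m - 1\<close>; inflating the contracted point by the block, shifted
  down by \<open>c\<close>, restores the permutation.\<close>

lemma block_perm_not_simple:
  assumes perm: "perm (l @ m @ r)" and m: "2 \<le> length m" "set m = {c + 1..c + length m}"
    and ne: "l @ r \<noteq> []"
  shows "\<not> simple_perm (l @ m @ r)"
proof -
  define k where "k = length m"
  define s where "s = length l"
  define t where "t = length r"
  define M where "M = s + 1 + t"
  define f where "f v = (if v \<le> c then v else v - (k - 1))" for v
  define \<tau> where "\<tau> = map (\<lambda>v. v - c) m"
  define \<sigma> where "\<sigma> = map f l @ [c + 1] @ map f r"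
  define \<tau>s where "\<tau>s = replicate s [1] @ [\<tau>] @ replicate t [1 :: nat]"
  have k: "2 \<le> k" using m by (simp add: k_def)
  have dist: "distinct l" "distinct r" "distinct m" "set l \<inter> set r = {}"
    and all: "set l \<union> {c + 1..c + k} \<union> set r = {1..s + k + t}"
    and W: "\<And>v. v \<in> set l \<union> set r \<Longrightarrow> v < c + 1 \<or> c + k < v"
    using perm m(2) unfolding perm_def k_def s_def t_def by (auto simp: Un_assoc add.assoc not_le)
  have "c + k \<in> {1..s + k + t}" 
  proof -
    have "c + k \<in> {c + 1..c + k}" using k by simp
    then show ?thesis using all by blast
  qed
  then have cM: "c + 1 \<le> M" by (simp add: M_def)
  have W': "1 \<le> v" "v \<le> s + k + t" if "v \<in> set l \<union> set r" for v
    using all that by auto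
  have f1: "f v \<noteq> c + 1" "f v \<in> {1..M}" if "v \<in> set l \<union> set r" for v
    using W[OF that] W'[OF that] k cM by (auto simp: f_def M_def)
  have f_inj: "inj_on f (set l \<union> set r)"
  proof (rule inj_onI)
    fix v w assume "v \<in> set l \<union> set r" "w \<in> set l \<union> set r" "f v = f w"
    then show "v = w" using W[of v] W[of w] k by (auto simp: f_def split: if_splits)
  qed
  have "distinct \<sigma>"
    using dist f_inj f1(1) by (auto simp: \<sigma>_def distinct_map inj_on_def) blast+
  have len\<sigma>: "length \<sigma> = M" by (simp add: \<sigma>_def M_def s_def t_def)
  have "set \<sigma> \<subseteq> {1..M}" using f1(2) cM by (auto simp: \<sigma>_def)
  then have set\<sigma>: "set \<sigma> = {1..M}"
    using distinct_card[OF \<open>distinct \<sigma>\<close>] len\<sigma> by (intro card_subset_eq) auto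
  have perm\<sigma>: "perm \<sigma>" using \<open>distinct \<sigma>\<close> set\<sigma> len\<sigma> by (simp add: perm_def)
  have perm\<tau>: "perm \<tau>"
  proof -
    have "(\<lambda>v. v - c) ` {c + 1..c + k} = {1..k}"
    proof
      show "{1..k} \<subseteq> (\<lambda>v. v - c) ` {c + 1..c + k}"
      proof
        fix x assume "x \<in> {1..k}"
        then show "x \<in> (\<lambda>v. v - c) ` {c + 1..c + k}" by (intro image_eqI[of _ _ "x + c"]) auto
      qed
    qed auto
    moreover have "inj_on (\<lambda>v. v - c) {c + 1..c + k}" by (auto simp: inj_on_def)
    ultimately show ?thesis using m(2) dist(3) by (simp add: perm_def \<tau>_def distinct_map k_def)
  qed
  have perm1: "perm [1]" by (simp add: perm_def)
  define off where "off i = (\<Sum>j | j < length \<sigma> \<and> \<sigma> ! j < \<sigma> ! i. length (\<tau>s ! j))" for i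
  \<comment> \<open>\<open>\<sigma> ! i - 1\<close> values lie below \<open>\<sigma> ! i\<close>;
    the contracted point, of value \<open>c + 1\<close>, contributes \<open>k - 1\<close> more if it
    is among them.\<close>
  have off: "off i = \<sigma> ! i - 1 + (if c + 1 < \<sigma> ! i then k - 1 else 0)" if "i < M" for i
  proof -
    let ?J = "{j. j < M \<and> \<sigma> ! j < \<sigma> ! i}"
    have s\<sigma>: "\<sigma> ! s = c + 1" by (simp add: \<sigma>_def s_def nth_append)
    have len: "length (\<tau>s ! j) = 1 + (if j = s then k - 1 else 0)" if "j < M" for j
      using that k by (auto simp: \<tau>s_def nth_append \<tau>_def k_def M_def nth_Cons split: nat.split)
    have "off i = (\<Sum>j\<in>?J. 1 + (if j = s then k - 1 else 0))"
      unfolding off_def len\<sigma> by (rule sum.cong) (use len in auto)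
    also have "\<dots> = card ?J + (\<Sum>j\<in>?J. if j = s then k - 1 else 0)"
      by (simp only: sum.distrib) simp
    also have "(\<Sum>j\<in>?J. if j = s then k - 1 else 0) = (if c + 1 < \<sigma> ! i then k - 1 else 0)"
      using s\<sigma> by (simp add: M_def)
    also have "card ?J = \<sigma> ! i - 1"
    proof -
      have "bij_betw ((!) \<sigma>) {..<M} {1..M}"
        using bij_betw_nth[OF \<open>distinct \<sigma>\<close>, of "{..<M}" "{1..M}"] len\<sigma> set\<sigma> by simp
      then have b: "inj_on ((!) \<sigma>) {..<M}" "(!) \<sigma> ` {..<M} = {1..M}" by (auto simp: bij_betw_def)
      have "\<sigma> ! i \<le> M" using that set\<sigma> len\<sigma> nth_mem[of i \<sigma>] by auto
      have "(!) \<sigma> ` ?J = {1..<\<sigma> ! i}"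
      proof
        show "{1..<\<sigma> ! i} \<subseteq> (!) \<sigma> ` ?J"
        proof
          fix x assume x: "x \<in> {1..<\<sigma> ! i}"
          then have "x \<in> (!) \<sigma> ` {..<M}" using b(2) \<open>\<sigma> ! i \<le> M\<close> by auto
          then show "x \<in> (!) \<sigma> ` ?J" using x by auto
        qed
      qed (use b(2) in auto)
      moreover have "inj_on ((!) \<sigma>) ?J" by (rule inj_on_subset[OF b(1)]) auto
      ultimately have "card ?J = card {1..<\<sigma> ! i}" by (metis card_image)
      then show ?thesis by simp
    qed
    finally show ?thesis .
  qed
  define g where "g i = map (\<lambda>v. v + off i) (\<tau>s ! i)" for i
  have ff: "1 + (f v - 1 + (if c + 1 < f v then k - 1 else 0)) = v" if "v \<in> set l \<union> set r" for v
    using W[OF that] W'[OF that] k by (auto simp: f_def)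
  have gl: "g i = [l ! i]" if "i < s" for i
  proof -
    have "\<sigma> ! i = f (l ! i)" "\<tau>s ! i = [1]" using that by (auto simp: \<sigma>_def \<tau>s_def s_def nth_append)
    moreover have "l ! i \<in> set l \<union> set r" using that by (simp add: s_def)
    ultimately show ?thesis using off[of i] that ff[of "l ! i"] by (simp add: g_def M_def)
  qed
  have gm: "g s = m"
  proof -
    have "\<sigma> ! s = c + 1" "\<tau>s ! s = \<tau>" by (auto simp: \<sigma>_def \<tau>s_def s_def nth_append)
    moreover have "map (\<lambda>v. v - c + c) m = m" using m(2) by (intro map_idI) auto
    ultimately show ?thesis using off[of s] by (simp add: g_def M_def \<tau>_def comp_def)
  qed
  have gr: "g (s + 1 + i) = [r ! i]" if "i < t" for i
  proof -
    have "\<sigma> ! (s + 1 + i) = f (r ! i)" "\<tau>s ! (s + 1 + i) = [1]"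
      using that by (auto simp: \<sigma>_def \<tau>s_def s_def t_def nth_append)
    moreover have "r ! i \<in> set l \<union> set r" using that by (simp add: t_def)
    ultimately show ?thesis using off[of "s + 1 + i"] that ff[of "r ! i"] by (simp add: g_def M_def)
  qed
  have "[0..<M] = [0..<s] @ [s] @ map (\<lambda>i. s + 1 + i) [0..<t]"
  proof (rule nth_equalityI)
    fix i assume "i < length [0..<M]"
    then show "[0..<M] ! i = ([0..<s] @ [s] @ map (\<lambda>i. s + 1 + i) [0..<t]) ! i"
      by (auto simp: nth_append M_def nth_Cons split: nat.split)
  qed (simp add: M_def)
  then have "concat (map g [0..<M]) =
      concat (map g [0..<s]) @ g s @ concat (map (\<lambda>i. g (s + 1 + i)) [0..<t])"
    by (simp add: comp_def)
  also have "map g [0..<s] = map (\<lambda>i. [l ! i]) [0..<s]" using gl by simp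
  also have "map (\<lambda>i. g (s + 1 + i)) [0..<t] = map (\<lambda>i. [r ! i]) [0..<t]" using gr by simp
  also have "concat (map (\<lambda>i. [l ! i]) [0..<s]) = l" by (simp add: s_def map_nth)
  also have "concat (map (\<lambda>i. [r ! i]) [0..<t]) = r" by (simp add: t_def map_nth)
  finally have "concat (map g [0..<M]) = l @ m @ r" unfolding gm .
  then have "l @ m @ r = inflation \<sigma> \<tau>s"
    unfolding inflation_def g_def off_def len\<sigma> ..
  moreover have "2 \<le> length \<sigma>" using ne len\<sigma> by (cases l; cases r) (auto simp: M_def s_def t_def)
  moreover have "length \<sigma> < length (l @ m @ r)" using m len\<sigma> by (simp add: M_def s_def t_def)
  moreover have "length \<tau>s = length \<sigma>" by (simp add: len\<sigma> \<tau>s_def M_def)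
  moreover have "\<forall>\<tau>'\<in>set \<tau>s. perm \<tau>' \<and> \<tau>' \<noteq> []"
    using perm\<tau> perm1 m(1) by (auto simp: \<tau>s_def \<tau>_def)
  ultimately show ?thesis using perm\<sigma> unfolding simple_perm_def by blast
qed

lemma convex_nat_set:
  fixes S :: "nat set"
  assumes "finite S" "S \<noteq> {}" and convex: "\<And>a b x. a \<in> S \<Longrightarrow> b \<in> S \<Longrightarrow> a < x \<Longrightarrow> x < b \<Longrightarrow> x \<in> S"
  obtains a where "S = {a..<a + card S}"
proof -
  define l u where "l = Min S" and "u = Max S"
  have lu: "l \<in> S" "u \<in> S" "\<And>x. x \<in> S \<Longrightarrow> l \<le> x \<and> x \<le> u"
    using assms(1,2) by (auto simp: l_def u_def)
  have "x \<in> S" if "l \<le> x" "x \<le> u" for x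
    using that convex[of l u x] lu(1,2) by (cases "x = l \<or> x = u") auto
  with lu(3) have S: "S = {l..u}" unfolding set_eq_iff atLeastAtMost_iff by blast
  have "l \<le> u" using lu by blast
  then have "l + card S = Suc u" by (simp add: S)
  then have "S = {l..<l + card S}" using S by auto
  then show ?thesis by (rule that)
qed

text \<open>If no outside point separated two points of \<open>X\<close> in either coordinate,
  positions and values of \<open>X\<close> would both be sets of consecutive integers, and
  \<open>X\<close> would be a block as in \<open>block_perm_not_simple\<close>.\<close>

lemma simple_perm_diagram_split:
  assumes simple: "simple_perm \<alpha>"
    and X: "X \<subseteq> diagram \<alpha>" "2 \<le> card X" "X \<noteq> diagram \<alpha>"
  obtains p a b where "p \<in> diagram \<alpha> - X" "a \<in> X" "b \<in> X"
    "(fst a < fst p \<and> fst p < fst b) \<or> (snd a < snd p \<and> snd p < snd b)"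
proof (rule ccontr)
  assume neg: "\<not> thesis"
  note witness = that
  have nosplit: "p \<in> X" if "p \<in> diagram \<alpha>" "a \<in> X" "b \<in> X"
    "(fst a < fst p \<and> fst p < fst b) \<or> (snd a < snd p \<and> snd p < snd b)" for p a b
    using neg witness[of p a b] that by blast
  define N where "N = length \<alpha>"
  define k where "k = card X"
  have perm: "perm \<alpha>" using simple by (simp add: simple_perm_def)
  have finX: "finite X" using X finite_subset finite_diagram by blast
  have X0: "X \<noteq> {}" using X by auto
  have inj: "inj_on fst X" "inj_on snd X"
    using inj_on_subset[OF inj_on_fst_diagram X(1)] inj_on_subset[OF inj_on_snd_diagram[OF perm] X(1)] by auto
  have fst_range: "fst ` diagram \<alpha> = {1..N}" by (auto simp: diagram_def N_def image_iff)
  have snd_range: "snd ` diagram \<alpha> = {1..N}"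
  proof -
    have "snd ` diagram \<alpha> = set \<alpha>"
    proof
      show "set \<alpha> \<subseteq> snd ` diagram \<alpha>"
      proof
        fix v assume "v \<in> set \<alpha>"
        then obtain i where "i < length \<alpha>" "v = \<alpha> ! i" by (auto simp: in_set_conv_nth)
        then have "(Suc i, v) \<in> diagram \<alpha>" by (auto simp: diagram_def)
        then show "v \<in> snd ` diagram \<alpha>" by force
      qed
    qed (auto simp: diagram_def)
    then show ?thesis using perm by (simp add: perm_def N_def)
  qed
  obtain a where a: "fst ` X = {a..<a + k}"
  proof (rule convex_nat_set[of "fst ` X"])
    fix u v x assume "u \<in> fst ` X" "v \<in> fst ` X" "u < x" "x < v"
    then obtain p q where pq: "p \<in> X" "q \<in> X" "u = fst p" "v = fst q" by blast
    then have "u \<in> fst ` diagram \<alpha>" "v \<in> fst ` diagram \<alpha>" using X(1) by blast+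
    then have "v \<le> N" "1 \<le> u" unfolding fst_range by auto
    then have "x \<in> fst ` diagram \<alpha>" unfolding fst_range using \<open>u < x\<close> \<open>x < v\<close> by auto
    then obtain w where "w \<in> diagram \<alpha>" "x = fst w" by blast
    then show "x \<in> fst ` X" using nosplit[of w p q] pq \<open>u < x\<close> \<open>x < v\<close> by blast
  qed (use finX X0 card_image[OF inj(1)] in \<open>auto simp: k_def\<close>)
  obtain d where d: "snd ` X = {d..<d + k}"
  proof (rule convex_nat_set[of "snd ` X"])
    fix u v x assume "u \<in> snd ` X" "v \<in> snd ` X" "u < x" "x < v"
    then obtain p q where pq: "p \<in> X" "q \<in> X" "u = snd p" "v = snd q" by blast
    then have "u \<in> snd ` diagram \<alpha>" "v \<in> snd ` diagram \<alpha>" using X(1) by blast+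
    then have "v \<le> N" "1 \<le> u" unfolding snd_range by auto
    then have "x \<in> snd ` diagram \<alpha>" unfolding snd_range using \<open>u < x\<close> \<open>x < v\<close> by auto
    then obtain w where "w \<in> diagram \<alpha>" "x = snd w" by blast
    then show "x \<in> snd ` X" using nosplit[of w p q] pq \<open>u < x\<close> \<open>x < v\<close> by blast
  qed (use finX X0 card_image[OF inj(2)] in \<open>auto simp: k_def\<close>)
  have k2: "2 \<le> k" using X by (simp add: k_def)
  have "fst ` X \<subseteq> {1..N}" using X(1) fst_range by blast
  moreover have "a \<in> fst ` X" "a + k - 1 \<in> fst ` X" unfolding a using k2 by auto
  ultimately have "a \<in> {1..N}" "a + k - 1 \<in> {1..N}" by blast+
  then have aN: "1 \<le> a" "a + k \<le> Suc N" by auto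
  have "snd ` X \<subseteq> {1..N}" using X(1) snd_range by blast
  moreover have "d \<in> snd ` X" unfolding d using k2 by auto
  ultimately have "d \<in> {1..N}" by blast
  then have d1: "1 \<le> d" by auto
  have kN: "k < N"
    using psubset_card_mono[OF finite_diagram, of X \<alpha>] X card_diagram[of \<alpha>] by (auto simp: k_def N_def)
  define l where "l = take (a - 1) \<alpha>"
  define m where "m = take k (drop (a - 1) \<alpha>)"
  define r where "r = drop k (drop (a - 1) \<alpha>)"
  have split: "\<alpha> = l @ m @ r" unfolding l_def m_def r_def append_take_drop_id ..
  have lenm: "length m = k" using aN by (simp add: m_def N_def)
  have "set m = snd ` X"
  proof -
    have "set m = (\<lambda>i. \<alpha> ! (a - 1 + i)) ` {0..<k}"
    proof -
      have "m ! i = \<alpha> ! (a - 1 + i)" if "i \<in> {0..<k}" for i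
        using that aN by (simp add: m_def N_def)
      then have "(\<lambda>i. \<alpha> ! (a - 1 + i)) ` {0..<k} = (!) m ` {0..<length m}" unfolding lenm by simp
      then show ?thesis using nth_image[of "length m" m] by simp
    qed
    also have "\<dots> = (\<lambda>i. \<alpha> ! (i - 1)) ` {a..<a + k}"
    proof -
      have eq: "{a..<a + k} = (+) a ` {0..<k}" by (simp add: add.commute)
      show ?thesis unfolding eq image_image by (rule image_cong) (use aN in auto)
    qed
    also have "\<dots> = (\<lambda>p. \<alpha> ! (fst p - 1)) ` X" by (simp add: a[symmetric] image_image)
    also have "\<dots> = snd ` X" using X(1) by (intro image_cong) (auto simp: diagram_def)
    finally show ?thesis .
  qed
  then have "set m = {(d - 1) + 1..(d - 1) + length m}" using d d1 k2 lenm by auto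
  moreover have "l @ r \<noteq> []" using split lenm kN by (auto simp: N_def)
  ultimately have "\<not> simple_perm (l @ m @ r)"
    using perm k2 lenm by (intro block_perm_not_simple) (auto simp: split[symmetric])
  with simple split show False by simp
qed

section \<open>A chain of overlapping patterns\<close>

datatype 'a site = Block nat 'a | Link nat | Ref

text \<open>\<open>no_interval\<close> expresses simplicity in a form that survives negating or
  swapping the ranks.\<close>

locale simple_pattern =
  fixes A :: "'a set" and r1 r2 :: "'a \<Rightarrow> int"
  assumes fin: "finite A" and inj1: "inj_on r1 A" and inj2: "inj_on r2 A" and card4: "4 \<le> card A"
    and no_interval: "X \<subseteq> A \<Longrightarrow> 2 \<le> card X \<Longrightarrow> X \<noteq> A \<Longrightarrow>
      \<exists>p\<in>A - X. \<exists>a\<in>X. \<exists>b\<in>X. r1 a < r1 p \<and> r1 p < r1 b \<or> r2 a < r2 p \<and> r2 p < r2 b"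

text \<open>
  The chain as a set of sites. \<open>Block i a\<close> is the point \<open>a\<close> of the \<open>i\<close>-th copy of the pattern,
  \<open>Link i\<close> is the point shared by the copies \<open>i\<close> and \<open>i + 1\<close>, and \<open>Ref\<close> is the additional point,
  shared by the copies \<open>0\<close> and \<open>n + 1\<close>. A site takes each coordinate from a point of some copy;
  coordinates are compared lexicographically, and the doubling of ranks lets \<open>Ref\<close> avoid ties
  with links. The sites in \<open>F0\<close>, \<open>F2\<close>, the links and \<open>Ref\<close> are not inflated.
\<close>

locale chain = simple_pattern A r1 r2 for A :: "'a set" and r1 r2 +
  fixes A0 A1 A2 F0 F2 :: "'a set" and e1 e2 :: nat and p q b r a0 :: 'a
  assumes sub: "A0 \<subseteq> A" "A1 \<subseteq> A" "A2 \<subseteq> A" and pq: "p \<in> A" "q \<in> A" and a0: "a0 \<in> A"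
    and e1: "e1 = 0 \<and> p \<notin> A0 \<union> A1 \<or> e1 = 1 \<and> p \<notin> A1 \<union> A2"
    and e2: "e2 = 0 \<and> q \<notin> A0 \<union> A1 \<or> e2 = 1 \<and> q \<notin> A1 \<union> A2"
begin

text \<open>\<open>e1\<close> and \<open>e2\<close> tell whether a coordinate of
  \<open>Link i\<close> comes from copy \<open>i\<close> or copy \<open>i + 1\<close>; the locale
  assumptions keep that place vacant in all the copies concerned. \<open>Ref\<close> is just right
  of \<open>b\<close> in the last copy and just below \<open>r\<close> in copy 0.\<close>

fun key1 :: "nat \<Rightarrow> 'a site \<Rightarrow> nat \<times> int" where
  "key1 n (Block i a) = (i, 2 * r1 a)"
| "key1 n (Link i) = (i + e1, 2 * r1 p)"
| "key1 n Ref = (n + 1, 2 * r1 b + 1)"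

fun key2 :: "nat \<Rightarrow> 'a site \<Rightarrow> nat \<times> int" where
  "key2 n (Block i a) = (i, 2 * r2 a)"
| "key2 n (Link i) = (i + e2, 2 * r2 q)"
| "key2 n Ref = (0, 2 * r2 r - 1)"

fun site :: "nat \<Rightarrow> 'a site \<Rightarrow> bool" where
  "site n (Block i a) \<longleftrightarrow> i = 0 \<and> a \<in> A0 \<or> 1 \<le> i \<and> i \<le> n \<and> a \<in> A1 \<or> i = n + 1 \<and> a \<in> A2"
| "site n (Link i) \<longleftrightarrow> i \<le> n"
| "site n Ref \<longleftrightarrow> True"

fun free :: "nat \<Rightarrow> 'a site \<Rightarrow> bool" where
  "free n (Block i a) \<longleftrightarrow> i = 0 \<and> a \<in> F0 \<or> i = n + 1 \<and> a \<in> F2"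
| "free n (Link i) \<longleftrightarrow> True"
| "free n Ref \<longleftrightarrow> True"

definition points :: "nat \<Rightarrow> ('a site \<times> 'a) set" where
  "points n = {(s, a). site n s \<and> a \<in> A \<and> (free n s \<longrightarrow> a = a0)}"

definition pkey1 :: "nat \<Rightarrow> 'a site \<times> 'a \<Rightarrow> (nat \<times> int) \<times> int" where
  "pkey1 n x = (key1 n (fst x), r1 (snd x))"

definition pkey2 :: "nat \<Rightarrow> 'a site \<times> 'a \<Rightarrow> (nat \<times> int) \<times> int" where
  "pkey2 n x = (key2 n (fst x), r2 (snd x))"

lemma finite_sites: "finite (Collect (site n))"
proof -
  have "Collect (site n) \<subseteq> (\<lambda>(i, a). Block i a) ` ({..n + 1} \<times> A) \<union> Link ` {..n} \<union> {Ref}"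
  proof
    fix s assume "s \<in> Collect (site n)"
    then show "s \<in> (\<lambda>(i, a). Block i a) ` ({..n + 1} \<times> A) \<union> Link ` {..n} \<union> {Ref}"
      using sub by (cases s) auto
  qed
  then show ?thesis by (rule finite_subset) (use fin in auto)
qed

lemma finite_points: "finite (points n)"
proof (rule finite_subset)
  show "points n \<subseteq> Collect (site n) \<times> A" by (auto simp: points_def)
  show "finite (Collect (site n) \<times> A)" using finite_sites fin by (rule finite_cartesian_product)
qed

lemma site_Block: "site n (Block i a) \<Longrightarrow> a \<in> A"
  using sub by auto

text \<open>Links do not tie with blocks because their places are vacant; \<open>Ref\<close> ties
  with nothing because its rank is odd and all others are even.\<close>

lemma inj_on_key1: "inj_on (key1 n) (Collect (site n))"
proof (rule inj_onI)
  fix s t assume st: "s \<in> Collect (site n)" "t \<in> Collect (site n)" "key1 n s = key1 n t"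
  have parity: "2 * x \<noteq> 2 * y + 1" "2 * x \<noteq> 2 * y - 1" for x y :: int by presburger+
  show "s = t"
  proof (cases s; cases t)
    fix i a j a' assume c: "s = Block i a" "t = Block j a'"
    then have "a \<in> A" "a' \<in> A" using st site_Block by blast+
    then show ?thesis using st(3) c inj_on_eq_iff[OF inj1] by simp
  next
    fix i a j assume c: "s = Block i a" "t = Link j"
    then have "a \<in> A" using st site_Block by blast
    then have "a = p" using st(3) c inj_on_eq_iff[OF inj1] pq by simp
    then show ?thesis using st c e1 by auto
  next
    fix i a j assume c: "s = Link j" "t = Block i a"
    then have "a \<in> A" using st site_Block by blast
    then have "a = p" using st(3) c inj_on_eq_iff[OF inj1] pq by simp
    then show ?thesis using st c e1 by auto
  next
    fix i a assume "s = Block i a" "t = Ref"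
    then show ?thesis using st(3) parity by simp
  next
    fix i a assume "s = Ref" "t = Block i a"
    then show ?thesis using st(3) parity by (metis key1.simps(1,3) prod.inject)
  next
    fix i assume "s = Link i" "t = Ref"
    then show ?thesis using st(3) parity by simp
  next
    fix i assume "s = Ref" "t = Link i"
    then show ?thesis using st(3) parity by (metis key1.simps(2,3) prod.inject)
  qed (use st(3) in auto)
qed

lemma inj_on_key2: "inj_on (key2 n) (Collect (site n))"
proof (rule inj_onI)
  fix s t assume st: "s \<in> Collect (site n)" "t \<in> Collect (site n)" "key2 n s = key2 n t"
  have parity: "2 * x \<noteq> 2 * y + 1" "2 * x \<noteq> 2 * y - 1" for x y :: int by presburger+
  show "s = t"
  proof (cases s; cases t)
    fix i a j a' assume c: "s = Block i a" "t = Block j a'"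
    then have "a \<in> A" "a' \<in> A" using st site_Block by blast+
    then show ?thesis using st(3) c inj_on_eq_iff[OF inj2] by simp
  next
    fix i a j assume c: "s = Block i a" "t = Link j"
    then have "a \<in> A" using st site_Block by blast
    then have "a = q" using st(3) c inj_on_eq_iff[OF inj2] pq by simp
    then show ?thesis using st c e2 by auto
  next
    fix i a j assume c: "s = Link j" "t = Block i a"
    then have "a \<in> A" using st site_Block by blast
    then have "a = q" using st(3) c inj_on_eq_iff[OF inj2] pq by simp
    then show ?thesis using st c e2 by auto
  next
    fix i a assume "s = Block i a" "t = Ref"
    then show ?thesis using st(3) parity by simp
  next
    fix i a assume "s = Ref" "t = Block i a"
    then show ?thesis using st(3) parity by (metis key2.simps(1,3) prod.inject)
  next
    fix i assume "s = Link i" "t = Ref"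
    then show ?thesis using st(3) parity by simp
  next
    fix i assume "s = Ref" "t = Link i"
    then show ?thesis using st(3) parity by (metis key2.simps(2,3) prod.inject)
  qed (use st(3) in auto)
qed

lemma inj_on_pkey1: "inj_on (pkey1 n) (points n)"
proof (rule inj_onI)
  fix x y assume xy: "x \<in> points n" "y \<in> points n" "pkey1 n x = pkey1 n y"
  then show "x = y"
    using inj_onD[OF inj_on_key1, of n "fst x" "fst y"] inj_onD[OF inj1, of "snd x" "snd y"]
    by (auto simp: pkey1_def points_def)
qed

lemma inj_on_pkey2: "inj_on (pkey2 n) (points n)"
proof (rule inj_onI)
  fix x y assume xy: "x \<in> points n" "y \<in> points n" "pkey2 n x = pkey2 n y"
  then show "x = y"
    using inj_onD[OF inj_on_key2, of n "fst x" "fst y"] inj_onD[OF inj2, of "snd x" "snd y"]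
    by (auto simp: pkey2_def points_def)
qed

section \<open>Insertion of an index, unnoticed by first-order formulas\<close>

fun pos :: "'a site \<Rightarrow> nat" where
  "pos (Block i a) = i"
| "pos (Link i) = i"
| "pos Ref = 0"

definition lift :: "nat \<Rightarrow> nat \<Rightarrow> nat" where
  "lift c i = (if i < c then i else Suc i)"

fun shift :: "nat \<Rightarrow> 'a site \<Rightarrow> 'a site" where
  "shift c (Block i a) = Block (lift c i) a"
| "shift c (Link i) = Link (lift c i)"
| "shift c Ref = Ref"

text \<open>The inequality on the left is strict because of the links: \<open>Link (c - 1)\<close>
  may take a coordinate from copy \<open>c\<close>, and an insertion at \<open>c\<close> would tear
  it off that copy.\<close>

definition far :: "nat \<Rightarrow> nat \<Rightarrow> 'a site \<Rightarrow> bool" where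
  "far c d s \<longleftrightarrow> pos s + d < c \<or> c + d \<le> pos s"

text \<open>With \<open>d\<close> the gap of the body, a quantifier may move the insertion by up to
  \<open>d + 1\<close>, and the points named before must still be \<open>d\<close> away afterwards;
  hence \<open>2 * d + 1\<close>.\<close>

fun gap :: "fo \<Rightarrow> nat" where
  "gap (FNot \<phi>) = gap \<phi>"
| "gap (FAnd \<phi> \<psi>) = max (gap \<phi>) (gap \<psi>)"
| "gap (FEx x \<phi>) = 2 * gap \<phi> + 1"
| "gap _ = 1"

lemma gap_pos: "1 \<le> gap \<phi>"
  by (induction \<phi>) auto

lemma shift_key1:
  assumes "site n s" "site n t" "far c 1 s" "far c 1 t" "1 \<le> c" "c \<le> n"
  shows "key1 (Suc n) (shift c s) < key1 (Suc n) (shift c t) \<longleftrightarrow> key1 n s < key1 n t"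
  using assms e1 by (cases s; cases t) (auto simp: lift_def far_def)

lemma shift_key2:
  assumes "site n s" "site n t" "far c 1 s" "far c 1 t" "1 \<le> c" "c \<le> n"
  shows "key2 (Suc n) (shift c s) < key2 (Suc n) (shift c t) \<longleftrightarrow> key2 n s < key2 n t"
  using assms e2 by (cases s; cases t) (auto simp: lift_def far_def)

lemma shift_inj: "shift c s = shift c t \<longleftrightarrow> s = t"
  by (cases s; cases t) (auto simp: lift_def split: if_splits)

lemma shift_site:
  assumes "1 \<le> c" "c \<le> n"
  shows "site (Suc n) (shift c s) \<longleftrightarrow> site n s" "free (Suc n) (shift c s) \<longleftrightarrow> free n s"
  using assms by (cases s; auto simp: lift_def split: if_splits)+

lemma shift_cong:
  assumes "far c d s" "c \<le> c' + d" "c' \<le> c + d"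
  shows "shift c' s = shift c s"
  using assms by (cases s) (auto simp: lift_def far_def)

lemma shift_surj:
  assumes "pos s' \<noteq> c"
  obtains s where "s' = shift c s"
proof (cases s')
  case (Block i a)
  then have "s' = shift c (Block (if i < c then i else i - 1) a)"
    using assms by (auto simp: lift_def)
  then show ?thesis by (rule that)
next
  case (Link i)
  then have "s' = shift c (Link (if i < c then i else i - 1))"
    using assms by (auto simp: lift_def)
  then show ?thesis by (rule that)
next
  case Ref
  then have "s' = shift c Ref" by simp
  then show ?thesis by (rule that)
qed

definition pshift :: "nat \<Rightarrow> 'a site \<times> 'a \<Rightarrow> 'a site \<times> 'a" where
  "pshift c x = (shift c (fst x), snd x)"

lemma fst_snd_pshift [simp]: "fst (pshift c x) = shift c (fst x)" "snd (pshift c x) = snd x"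
  by (simp_all add: pshift_def)

lemma pshift_points:
  assumes "1 \<le> c" "c \<le> n"
  shows "pshift c x \<in> points (Suc n) \<longleftrightarrow> x \<in> points n"
  using shift_site[OF assms] by (cases x) (auto simp: points_def pshift_def)

lemma pshift_pkey:
  assumes "x \<in> points n" "y \<in> points n" "far c 1 (fst x)" "far c 1 (fst y)" "1 \<le> c" "c \<le> n"
  shows "pkey1 (Suc n) (pshift c x) < pkey1 (Suc n) (pshift c y) \<longleftrightarrow> pkey1 n x < pkey1 n y"
    and "pkey2 (Suc n) (pshift c x) < pkey2 (Suc n) (pshift c y) \<longleftrightarrow> pkey2 n x < pkey2 n y"
proof -
  have h: "site n (fst x)" "site n (fst y)" using assms by (auto simp: points_def)
  have lex: "(P, u) < (Q, v) \<longleftrightarrow> P < Q \<or> \<not> Q < P \<and> u < v" for P Q :: "nat \<times> int" and u v :: int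
    by auto
  note k1 = shift_key1[OF h assms(3-6)] shift_key1[OF h(2,1) assms(4,3,5,6)]
  note k2 = shift_key2[OF h assms(3-6)] shift_key2[OF h(2,1) assms(4,3,5,6)]
  show "pkey1 (Suc n) (pshift c x) < pkey1 (Suc n) (pshift c y) \<longleftrightarrow> pkey1 n x < pkey1 n y"
    unfolding pkey1_def fst_snd_pshift lex k1 ..
  show "pkey2 (Suc n) (pshift c x) < pkey2 (Suc n) (pshift c y) \<longleftrightarrow> pkey2 n x < pkey2 n y"
    unfolding pkey2_def fst_snd_pshift lex k2 ..
qed

text \<open>
  Inserting an index at \<open>c\<close> is not noticed by \<open>\<phi>\<close> as long as all named points are far from \<open>c\<close>.
  When a quantifier picks a point near \<open>c\<close>, the insertion is moved away from it; this does not
  affect the points named before.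
\<close>

lemma sat_pshift:
  assumes "\<And>x. x \<in> fv \<phi> \<Longrightarrow> e x \<in> points n \<and> far c (gap \<phi>) (fst (e x))"
    and "gap \<phi> \<le> c" "c + gap \<phi> \<le> n + 1"
  shows "sat_keys (points n) (pkey1 n) (pkey2 n) e \<phi> \<longleftrightarrow>
    sat_keys (points (Suc n)) (pkey1 (Suc n)) (pkey2 (Suc n)) (pshift c \<circ> e) \<phi>"
  using assms
proof (induction \<phi> arbitrary: e c)
  case (FLess1 x y)
  then show ?case using pshift_pkey(1)[of "e x" n "e y" c] by simp
next
  case (FLess2 x y)
  then show ?case using pshift_pkey(2)[of "e x" n "e y" c] by simp
next
  case (FEq x y)
  then show ?case by (simp add: prod_eq_iff shift_inj)
next
  case (FNot \<phi>)
  then show ?case using FNot.IH[of e c] by simp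
next
  case (FAnd \<phi> \<psi>)
  have *: "e x \<in> points n \<and> far c (gap \<phi>) (fst (e x))" if "x \<in> fv \<phi>" for x
    using FAnd.prems(1)[of x] that by (auto simp: far_def max_def split: if_splits)
  have **: "e x \<in> points n \<and> far c (gap \<psi>) (fst (e x))" if "x \<in> fv \<psi>" for x
    using FAnd.prems(1)[of x] that by (auto simp: far_def max_def split: if_splits)
  show ?case
    using FAnd.IH(1)[OF *] FAnd.IH(2)[OF **] FAnd.prems(2,3) by simp
next
  case (FEx x \<phi>)
  define d where "d = gap \<phi>"
  have c: "2 * d + 1 \<le> c" "c + 2 * d + 1 \<le> n + 1" "1 \<le> d"
    using FEx.prems gap_pos[of \<phi>] by (auto simp: d_def)
  have step: "sat_keys (points n) (pkey1 n) (pkey2 n) (e(x := a)) \<phi> \<longleftrightarrow>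
      sat_keys (points (Suc n)) (pkey1 (Suc n)) (pkey2 (Suc n)) ((pshift c \<circ> e)(x := pshift c' a)) \<phi>"
    if c': "c' = c + d + 1 \<or> c' = c - d" and a: "a \<in> points n" "far c' d (fst a)" for c' a
  proof -
    have vars: "e y \<in> points n \<and> far c' d (fst (e y)) \<and> pshift c' (e y) = pshift c (e y)"
      if "y \<in> fv \<phi>" "y \<noteq> x" for y
    proof -
      have y: "e y \<in> points n" "far c (2 * d + 1) (fst (e y))"
        using FEx.prems(1)[of y] that by (auto simp: d_def)
      moreover have "shift c' (fst (e y)) = shift c (fst (e y))"
        by (rule shift_cong[OF y(2)]) (use c' c in auto)
      moreover have "far c' d (fst (e y))" using y(2) c' c by (auto simp: far_def)
      ultimately show ?thesis by (simp add: prod_eq_iff)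
    qed
    have "sat_keys (points n) (pkey1 n) (pkey2 n) (e(x := a)) \<phi> \<longleftrightarrow>
      sat_keys (points (Suc n)) (pkey1 (Suc n)) (pkey2 (Suc n)) (pshift c' \<circ> e(x := a)) \<phi>"
    proof (rule FEx.IH)
      fix y assume "y \<in> fv \<phi>"
      then show "(e(x := a)) y \<in> points n \<and> far c' (gap \<phi>) (fst ((e(x := a)) y))"
        using vars[of y] a by (auto simp: d_def)
    qed (use c' c in \<open>auto simp: d_def\<close>)
    also have "\<dots> \<longleftrightarrow> sat_keys (points (Suc n)) (pkey1 (Suc n)) (pkey2 (Suc n))
        ((pshift c \<circ> e)(x := pshift c' a)) \<phi>"
    proof (rule sat_cong_fv)
      fix y assume "y \<in> fv \<phi>"
      then show "(pshift c' \<circ> e(x := a)) y = ((pshift c \<circ> e)(x := pshift c' a)) y"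
        using vars[of y] by auto
    qed
    finally show ?thesis .
  qed
  show ?case
    unfolding sat.simps
  proof
    assume "\<exists>a\<in>points n. sat_keys (points n) (pkey1 n) (pkey2 n) (e(x := a)) \<phi>"
    then obtain a where a: "a \<in> points n" "sat_keys (points n) (pkey1 n) (pkey2 n) (e(x := a)) \<phi>"
      by blast
    \<comment> \<open>The insertion escapes to the side opposite the picked point, just far enough
      to be at distance \<open>d\<close> from it.\<close>
    define c' where "c' = (if pos (fst a) \<le> c then c + d + 1 else c - d)"
    have c': "c' = c + d + 1 \<or> c' = c - d" "far c' d (fst a)" "1 \<le> c'" "c' \<le> n"
      using c by (auto simp: c'_def far_def)
    have "pshift c' a \<in> points (Suc n)" using pshift_points[OF c'(3,4)] a(1) by blast
    then show "\<exists>a\<in>points (Suc n). sat_keys (points (Suc n)) (pkey1 (Suc n)) (pkey2 (Suc n))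
        ((pshift c \<circ> e)(x := a)) \<phi>"
      using step[OF c'(1) a(1) c'(2)] a(2) by blast
  next
    assume "\<exists>a\<in>points (Suc n). sat_keys (points (Suc n)) (pkey1 (Suc n)) (pkey2 (Suc n))
        ((pshift c \<circ> e)(x := a)) \<phi>"
    then obtain a' where a': "a' \<in> points (Suc n)"
      "sat_keys (points (Suc n)) (pkey1 (Suc n)) (pkey2 (Suc n)) ((pshift c \<circ> e)(x := a')) \<phi>"
      by blast
    \<comment> \<open>Same choice from within the longer chain. There \<open>c'\<close> is the
      inserted index itself, so \<open>a'\<close> must not sit at it in order to have a
      preimage.\<close>
    define c' where "c' = (if pos (fst a') \<le> c then c + d + 1 else c - d)"
    have c': "c' = c + d + 1 \<or> c' = c - d" "1 \<le> c'" "c' \<le> n" "pos (fst a') \<noteq> c'"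
      using c by (auto simp: c'_def)
    obtain s where s: "fst a' = shift c' s" using shift_surj[OF c'(4)] by blast
    define a where "a = (s, snd a')"
    have a: "a' = pshift c' a" using s by (simp add: a_def prod_eq_iff)
    have "a \<in> points n" using pshift_points[OF c'(2,3)] a' a by blast
    moreover have "far c' d (fst a)"
      using s c unfolding a_def far_def c'_def
      by (cases s) (auto simp: lift_def split: if_splits)
    ultimately show "\<exists>a\<in>points n. sat_keys (points n) (pkey1 n) (pkey2 n) (e(x := a)) \<phi>"
      using step[OF c'(1)] a a'(2) by blast
  qed
qed

text \<open>No point is named yet, so the insertion only has to keep away from both ends; index
  \<open>gap \<phi>\<close> does so once \<open>n\<close> is at least
  \<open>2 * gap \<phi>\<close>.\<close>

lemma sat_points_Suc:
  assumes "sentence \<phi>" "2 * gap \<phi> \<le> n"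
  shows "sat_keys (points n) (pkey1 n) (pkey2 n) e \<phi> \<longleftrightarrow>
    sat_keys (points (Suc n)) (pkey1 (Suc n)) (pkey2 (Suc n)) (pshift (gap \<phi>) \<circ> e) \<phi>"
proof (rule sat_pshift)
  fix x assume "x \<in> fv \<phi>"
  then show "e x \<in> points n \<and> far (gap \<phi>) (gap \<phi>) (fst (e x))"
    using assms(1) by (simp add: sentence_def)
qed (use assms(2) in linarith)+

end

section \<open>Colourings of the chain\<close>

text \<open>For comparisons with \<open>Ref\<close>: moving a doubled rank by one matters only
  against the same rank.\<close>

lemma double_shift:
  fixes x y :: int
  shows "2 * y < 2 * x - 1 \<longleftrightarrow> y < x" "2 * x + 1 < 2 * y \<longleftrightarrow> x < y"
    and "x \<noteq> y \<Longrightarrow> 2 * x - 1 < 2 * y \<longleftrightarrow> x < y" "x \<noteq> y \<Longrightarrow> 2 * y < 2 * x + 1 \<longleftrightarrow> y < x"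
  by auto

context simple_pattern
begin

section \<open>Consequences of simplicity\<close>

lemma interval_trivial:
  assumes "X \<subseteq> A" "X \<noteq> A"
    and "\<And>p a b. p \<in> A \<Longrightarrow> p \<notin> X \<Longrightarrow> a \<in> X \<Longrightarrow> b \<in> X \<Longrightarrow>
      \<not> (r1 a < r1 p \<and> r1 p < r1 b) \<and> \<not> (r2 a < r2 p \<and> r2 p < r2 b)"
  shows "card X \<le> 1"
proof (rule ccontr)
  assume "\<not> card X \<le> 1"
  then have "2 \<le> card X" by simp
  from no_interval[OF assms(1) this assms(2)] assms(3) show False by blast
qed

text \<open>Both sides are intervals; if neither were everything, each would have at most one point,
  against \<open>card4\<close>.\<close>

lemma sum_indecomposable:
  assumes "\<And>a b. a \<in> A \<Longrightarrow> b \<in> A \<Longrightarrow> P a \<Longrightarrow> \<not> P b \<Longrightarrow> r1 a < r1 b \<and> r2 a < r2 b"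
  shows "(\<forall>a\<in>A. P a) \<or> (\<forall>a\<in>A. \<not> P a)"
proof (rule ccontr)
  assume neg: "\<not> ?thesis"
  let ?X = "{a\<in>A. P a}" and ?Y = "{a\<in>A. \<not> P a}"
  have X: "?X \<noteq> A" "?Y \<noteq> A" using neg by blast+
  have "card ?X \<le> 1"
  proof (rule interval_trivial)
    fix p a b assume "p \<in> A" "p \<notin> ?X" "a \<in> ?X" "b \<in> ?X"
    then have "r1 b < r1 p \<and> r2 b < r2 p" using assms[of b p] by blast
    then show "\<not> (r1 a < r1 p \<and> r1 p < r1 b) \<and> \<not> (r2 a < r2 p \<and> r2 p < r2 b)" by simp
  qed (use X in auto)
  moreover have "card ?Y \<le> 1"
  proof (rule interval_trivial)
    fix p a b assume "p \<in> A" "p \<notin> ?Y" "a \<in> ?Y" "b \<in> ?Y"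
    then have "r1 p < r1 a \<and> r2 p < r2 a" using assms[of p a] by blast
    then show "\<not> (r1 a < r1 p \<and> r1 p < r1 b) \<and> \<not> (r2 a < r2 p \<and> r2 p < r2 b)" by simp
  qed (use X in auto)
  moreover have "card A \<le> card ?X + card ?Y"
  proof -
    have "A = ?X \<union> ?Y" by blast
    then show ?thesis by (metis card_Un_le)
  qed
  ultimately show False using card4 by simp
qed

text \<open>The points other than \<open>z\<close> would form an interval of at least three
  points.\<close>

lemma no_corner:
  assumes "z \<in> A"
    and "(\<forall>a\<in>A - {z}. r1 a < r1 z) \<or> (\<forall>a\<in>A - {z}. r1 z < r1 a)"
    and "(\<forall>a\<in>A - {z}. r2 a < r2 z) \<or> (\<forall>a\<in>A - {z}. r2 z < r2 a)"
  shows False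
proof -
  have "card (A - {z}) \<le> 1"
  proof (rule interval_trivial)
    fix p a b assume "p \<in> A" "p \<notin> A - {z}" "a \<in> A - {z}" "b \<in> A - {z}"
    then have "p = z" by blast
    have "\<not> (r1 a < r1 z \<and> r1 z < r1 b)"
      using assms(2) \<open>a \<in> A - {z}\<close> \<open>b \<in> A - {z}\<close> by (meson less_asym)
    moreover have "\<not> (r2 a < r2 z \<and> r2 z < r2 b)"
      using assms(3) \<open>a \<in> A - {z}\<close> \<open>b \<in> A - {z}\<close> by (meson less_asym)
    ultimately show "\<not> (r1 a < r1 p \<and> r1 p < r1 b) \<and> \<not> (r2 a < r2 p \<and> r2 p < r2 b)"
      using \<open>p = z\<close> by simp
  qed (use assms(1) in auto)
  then show False using assms(1) card4 by simp
qed

lemma nonempty: "A \<noteq> {}"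
  using card4 by auto

lemma least1: obtains x where "x \<in> A" "\<And>a. a \<in> A \<Longrightarrow> a \<noteq> x \<Longrightarrow> r1 x < r1 a"
proof -
  obtain x where x: "x \<in> A" "\<And>a. a \<in> A \<Longrightarrow> r1 x \<le> r1 a"
    using ex_is_arg_min_if_finite[OF fin nonempty, of r1] by (auto simp: is_arg_min_def not_less)
  moreover have "r1 x < r1 a" if "a \<in> A" "a \<noteq> x" for a
    using x that inj_onD[OF inj1, of x a] by (metis order_le_less)
  ultimately show ?thesis by (metis that)
qed

end

lemma simple_pattern_flip:
  assumes "simple_pattern A r1 r2"
  shows "simple_pattern A (\<lambda>a. - r1 a) r2"
proof -
  interpret simple_pattern A r1 r2 by fact
  show ?thesis
  proof
    fix X assume "X \<subseteq> A" "2 \<le> card X" "X \<noteq> A"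
    from no_interval[OF this]
    show "\<exists>p\<in>A - X. \<exists>a\<in>X. \<exists>b\<in>X. - r1 a < - r1 p \<and> - r1 p < - r1 b \<or> r2 a < r2 p \<and> r2 p < r2 b"
      unfolding neg_less_iff_less by blast
  qed (use fin inj1 inj2 card4 in \<open>auto simp: inj_on_def\<close>)
qed

lemma simple_pattern_transp:
  assumes "simple_pattern A r1 r2"
  shows "simple_pattern A r2 r1"
proof -
  interpret simple_pattern A r1 r2 by fact
  show ?thesis
  proof
    fix X assume "X \<subseteq> A" "2 \<le> card X" "X \<noteq> A"
    from no_interval[OF this]
    show "\<exists>p\<in>A - X. \<exists>a\<in>X. \<exists>b\<in>X. r2 a < r2 p \<and> r2 p < r2 b \<or> r1 a < r1 p \<and> r1 p < r1 b"
      by blast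
  qed (use fin inj1 inj2 card4 in auto)
qed

context simple_pattern
begin

lemma greatest1: obtains x where "x \<in> A" "\<And>a. a \<in> A \<Longrightarrow> a \<noteq> x \<Longrightarrow> r1 a < r1 x"
  using simple_pattern.least1[OF simple_pattern_flip[OF simple_pattern_axioms]] by (metis neg_less_iff_less)

lemma least2: obtains x where "x \<in> A" "\<And>a. a \<in> A \<Longrightarrow> a \<noteq> x \<Longrightarrow> r2 x < r2 a"
  using simple_pattern.least1[OF simple_pattern_transp[OF simple_pattern_axioms]] by metis

lemma greatest2: obtains x where "x \<in> A" "\<And>a. a \<in> A \<Longrightarrow> a \<noteq> x \<Longrightarrow> r2 a < r2 x"
  using simple_pattern.greatest1[OF simple_pattern_transp[OF simple_pattern_axioms]] by metis

lemma embeds_inj_on: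
  assumes "embeds A r1 r2 U k1 k2 f"
  shows "inj_on f A"
proof (rule inj_onI)
  fix a b assume "a \<in> A" "b \<in> A" "f a = f b"
  then have "\<not> r1 a < r1 b" "\<not> r1 b < r1 a" using assms by (auto simp: embeds_def)
  then have "r1 a = r1 b" by simp
  then show "a = b" using \<open>a \<in> A\<close> \<open>b \<in> A\<close> inj1 by (simp add: inj_on_def)
qed

end

context chain
begin

text \<open>
  A site that is not free is replaced by a copy of the pattern, which contains both colours in
  every valid colouring. Hence only the colours of the free sites matter.
\<close>

definition proper :: "nat \<Rightarrow> ('a site \<Rightarrow> bool) \<Rightarrow> bool" where
  "proper n c \<longleftrightarrow> (\<forall>g. embeds A r1 r2 (Collect (site n)) (key1 n) (key2 n) g \<longrightarrow>
     (\<exists>a\<in>A. \<exists>b\<in>A. free n (g a) \<and> free n (g b) \<and> c (g a) \<noteq> c (g b)))"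

lemma lex_less: "(x, u) < (y, v) \<longleftrightarrow> x < y \<or> \<not> y < x \<and> u < v"
  for x y :: "nat \<times> int" and u v :: int
  by auto

text \<open>If all free sites met by an embedding into sites had colour \<open>k\<close>, choosing a
  point of colour \<open>k\<close> in each inflated site that it meets would complete a
  monochromatic embedding into points.\<close>

lemma proper_if_two_colourable:
  assumes "two_colourable A r1 r2 (points n) (pkey1 n) (pkey2 n)"
  shows "\<exists>c. proper n c"
proof -
  obtain c where c: "\<And>f. embeds A r1 r2 (points n) (pkey1 n) (pkey2 n) f \<Longrightarrow>
      \<exists>a\<in>A. \<exists>b\<in>A. (c (f a) :: bool) \<noteq> c (f b)"
    using assms unfolding two_colourable_def by blast
  have both: "\<exists>a\<in>A. c (s, a) = k" if s: "site n s" "\<not> free n s" for s k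
  proof -
    have "embeds A r1 r2 (points n) (pkey1 n) (pkey2 n) (\<lambda>a. (s, a))"
      using s by (auto simp: embeds_def points_def pkey1_def pkey2_def)
    from c[OF this] show ?thesis by metis
  qed
  have "proper n (\<lambda>s. c (s, a0))"
    unfolding proper_def
  proof (intro allI impI)
    fix g assume g: "embeds A r1 r2 (Collect (site n)) (key1 n) (key2 n) g"
    show "\<exists>a\<in>A. \<exists>b\<in>A. free n (g a) \<and> free n (g b) \<and> c (g a, a0) \<noteq> c (g b, a0)"
    proof (rule ccontr)
      assume "\<not> ?thesis"
      then obtain k where k: "\<And>a. a \<in> A \<Longrightarrow> free n (g a) \<Longrightarrow> c (g a, a0) = k" by metis
      have site: "site n (g a)" if "a \<in> A" for a using g that by (auto simp: embeds_def)
      have "\<exists>u\<in>A. c (g a, u) = k \<and> (free n (g a) \<longrightarrow> u = a0)" if "a \<in> A" for a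
        using both[OF site[OF that]] k[OF that] a0 by (cases "free n (g a)") auto
      then obtain u where u: "\<And>a. a \<in> A \<Longrightarrow> u a \<in> A \<and> c (g a, u a) = k \<and> (free n (g a) \<longrightarrow> u a = a0)"
        by metis
      have lt: "(r1 a < r1 b \<longleftrightarrow> key1 n (g a) < key1 n (g b)) \<and> (r2 a < r2 b \<longleftrightarrow> key2 n (g a) < key2 n (g b))"
        if "a \<in> A" "b \<in> A" for a b
        using g that by (auto simp: embeds_def)
      have "embeds A r1 r2 (points n) (pkey1 n) (pkey2 n) (\<lambda>a. (g a, u a))"
        unfolding embeds_def
      proof (intro conjI ballI)
        show "(\<lambda>a. (g a, u a)) ` A \<subseteq> points n" using site u by (auto simp: points_def)
      next
        fix a b assume ab: "a \<in> A" "b \<in> A"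
        show "r1 a < r1 b \<longleftrightarrow> pkey1 n (g a, u a) < pkey1 n (g b, u b)"
          unfolding pkey1_def fst_conv snd_conv lex_less
          using lt[OF ab] lt[OF ab(2,1)] inj_onD[OF inj1, of a b] ab by (cases "a = b") auto
        show "r2 a < r2 b \<longleftrightarrow> pkey2 n (g a, u a) < pkey2 n (g b, u b)"
          unfolding pkey2_def fst_conv snd_conv lex_less
          using lt[OF ab] lt[OF ab(2,1)] inj_onD[OF inj2, of a b] ab by (cases "a = b") auto
      qed
      from c[OF this] u show False by simp
    qed
  qed
  then show ?thesis by blast
qed

text \<open>Inside an inflated site only the point \<open>a0\<close> gets colour True. The points of
  the pattern sent to one site form an interval, so an embedding either stays in one site, where it
  covers a whole copy and sees both colours, or meets every site at most once and is then an
  embedding into sites.\<close>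

lemma two_colourable_if_proper:
  assumes "proper n c"
  shows "two_colourable A r1 r2 (points n) (pkey1 n) (pkey2 n)"
  unfolding two_colourable_def
proof (intro exI allI impI)
  let ?c = "\<lambda>x. if free n (fst x) then c (fst x) else snd x = a0"
  fix f assume f: "embeds A r1 r2 (points n) (pkey1 n) (pkey2 n) f"
  define g where "g = (\<lambda>a. fst (f a))"
  have pts: "site n (g a)" "snd (f a) \<in> A" "free n (g a) \<longrightarrow> snd (f a) = a0" if "a \<in> A" for a
    using f that by (auto simp: embeds_def points_def g_def split: prod.splits)
  have fa: "f a = (g a, snd (f a))" for a by (simp add: g_def)
  have finj: "inj_on f A" by (rule embeds_inj_on[OF f])
  have lt: "r1 a < r1 b \<longleftrightarrow> key1 n (g a) < key1 n (g b) \<or> \<not> key1 n (g b) < key1 n (g a) \<and> r1 (snd (f a)) < r1 (snd (f b))"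
     "r2 a < r2 b \<longleftrightarrow> key2 n (g a) < key2 n (g b) \<or> \<not> key2 n (g b) < key2 n (g a) \<and> r2 (snd (f a)) < r2 (snd (f b))"
    if "a \<in> A" "b \<in> A" for a b
    using f that unfolding embeds_def pkey1_def pkey2_def lex_less g_def by blast+
  have le: "r1 a < r1 b \<Longrightarrow> key1 n (g a) \<le> key1 n (g b)" "r2 a < r2 b \<Longrightarrow> key2 n (g a) \<le> key2 n (g b)"
    if "a \<in> A" "b \<in> A" for a b
    using lt[OF that] by (meson not_le order.asym)+
  have fibre: "{a\<in>A. g a = s} = A \<or> card {a\<in>A. g a = s} \<le> 1" for s
  proof (rule disjCI)
    assume "\<not> card {a\<in>A. g a = s} \<le> 1"
    show "{a\<in>A. g a = s} = A"
    proof (rule ccontr)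
      assume ne: "{a\<in>A. g a = s} \<noteq> A"
      have "card {a\<in>A. g a = s} \<le> 1"
      proof (rule interval_trivial[OF _ ne])
        fix p a b assume h: "p \<in> A" "p \<notin> {a\<in>A. g a = s}" "a \<in> {a\<in>A. g a = s}" "b \<in> {a\<in>A. g a = s}"
        have "g p = s" if "r1 a < r1 p" "r1 p < r1 b"
          using le(1)[of a p] le(1)[of p b] h that inj_onD[OF inj_on_key1, of n "g p" s] pts(1)
          by (auto dest: antisym)
        moreover have "g p = s" if "r2 a < r2 p" "r2 p < r2 b"
          using le(2)[of a p] le(2)[of p b] h that inj_onD[OF inj_on_key2, of n "g p" s] pts(1)
          by (auto dest: antisym)
        ultimately show "\<not> (r1 a < r1 p \<and> r1 p < r1 b) \<and> \<not> (r2 a < r2 p \<and> r2 p < r2 b)"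
          using h by blast
      qed auto
      with \<open>\<not> card {a\<in>A. g a = s} \<le> 1\<close> show False by blast
    qed
  qed
  show "\<exists>a\<in>A. \<exists>b\<in>A. ?c (f a) \<noteq> ?c (f b)"
  proof (cases "\<exists>s. {a\<in>A. g a = s} = A")
    case True
    then obtain s where s: "\<And>a. a \<in> A \<Longrightarrow> g a = s" by blast
    have inj: "inj_on (\<lambda>a. snd (f a)) A"
      using finj s fa unfolding inj_on_def by metis
    have "(\<lambda>a. snd (f a)) ` A = A"
      using inj fin pts(2) by (intro endo_inj_surj) auto
    then obtain a where a: "a \<in> A" "snd (f a) = a0" using a0 by (metis imageE)
    obtain b where b: "b \<in> A" "b \<noteq> a"
      using card4 a(1) fin by (metis card_le_Suc0_iff_eq numeral_le_one_iff One_nat_def order_trans semiring_norm(69))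
    then have "snd (f b) \<noteq> a0" using inj a by (auto simp: inj_on_def)
    then have "\<not> free n s" using pts(3)[OF b(1)] s[OF b(1)] by simp
    then have "?c (f a) \<noteq> ?c (f b)"
      using a b s \<open>snd (f b) \<noteq> a0\<close> by (simp add: g_def)
    then show ?thesis using a b by blast
  next
    case False
    have ginj: "inj_on g A"
    proof (rule inj_onI)
      fix a b assume ab: "a \<in> A" "b \<in> A" "g a = g b"
      have "card {x\<in>A. g x = g b} \<le> Suc 0" using fibre[of "g b"] False by auto
      then show "a = b" using ab fin by (subst (asm) card_le_Suc0_iff_eq) auto
    qed
    have kne: "key1 n (g a) \<noteq> key1 n (g b)" "key2 n (g a) \<noteq> key2 n (g b)"
      if "a \<in> A" "b \<in> A" "a \<noteq> b" for a b
      using that pts(1) inj_onD[OF inj_on_key1, of n "g a" "g b"] inj_onD[OF inj_on_key2, of n "g a" "g b"]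
        inj_onD[OF ginj, of a b] by auto
    have "embeds A r1 r2 (Collect (site n)) (key1 n) (key2 n) g"
      unfolding embeds_def
    proof (intro conjI ballI)
      show "g ` A \<subseteq> Collect (site n)" using pts by auto
    next
      fix a b assume ab: "a \<in> A" "b \<in> A"
      show "r1 a < r1 b \<longleftrightarrow> key1 n (g a) < key1 n (g b)"
        using lt(1)[OF ab] kne(1)[OF ab] by (cases "a = b") (auto dest: antisym simp: not_less)
      show "r2 a < r2 b \<longleftrightarrow> key2 n (g a) < key2 n (g b)"
        using lt(2)[OF ab] kne(2)[OF ab] by (cases "a = b") (auto dest: antisym simp: not_less)
    qed
    then obtain a b where "a \<in> A" "b \<in> A" "free n (g a)" "free n (g b)" "c (g a) \<noteq> c (g b)"
      using assms unfolding proper_def by blast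
    then show ?thesis by (auto simp: g_def)
  qed
qed

lemma undefinable_if_parity:
  assumes "\<And>n. even n \<Longrightarrow> \<exists>c. proper n c" and "\<And>n. odd n \<Longrightarrow> \<not> (\<exists>c. proper n c)"
  shows "undefinable A r1 r2"
  unfolding undefinable_def
proof (intro allI impI)
  fix \<phi> assume s: "sentence \<phi>"
  \<comment> \<open>Even, hence colourable, and just long enough for
    \<open>sat_points_Suc\<close>.\<close>
  define n where "n = 2 * gap \<phi>"
  have "two_colourable A r1 r2 (points n) (pkey1 n) (pkey2 n)"
    using assms(1)[of n] two_colourable_if_proper by (auto simp: n_def)
  moreover have "\<not> two_colourable A r1 r2 (points (Suc n)) (pkey1 (Suc n)) (pkey2 (Suc n))"
    using assms(2)[of "Suc n"] proper_if_two_colourable by (auto simp: n_def)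
  ultimately show "\<exists>\<pi> \<sigma>. perm \<pi> \<and> perm \<sigma> \<and> (models \<pi> \<phi> \<longleftrightarrow> models \<sigma> \<phi>) \<and>
      two_colourable A r1 r2 (diagram \<pi>) fst snd \<and> \<not> two_colourable A r1 r2 (diagram \<sigma>) fst snd"
    by (rule separation_by_perms[OF s finite_points inj_on_pkey1 inj_on_pkey2
        finite_points inj_on_pkey1 inj_on_pkey2
        sat_points_Suc[OF s eq_imp_le[OF n_def[symmetric]], where e = undefined]])
qed

lemma links_alternate:
  assumes "\<And>i. i < n \<Longrightarrow> c (Link i) \<noteq> c (Link (Suc i))" "i \<le> n"
  shows "(c :: 'a site \<Rightarrow> bool) (Link i) = (c (Link 0) = even i)"
  using assms(2)
proof (induction i)
  case (Suc i)
  then show ?case using assms(1)[of i] by auto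
qed simp

lemma card_block_le:
  assumes "embeds A r1 r2 (Collect (site n)) (key1 n) (key2 n) g"
    and "X \<subseteq> A" "finite S" "\<And>a. a \<in> X \<Longrightarrow> \<exists>u\<in>S. g a = Block i u"
  shows "card X \<le> card S"
proof -
  have "g ` X \<subseteq> Block i ` S" using assms(4) by blast
  then have "card (g ` X) \<le> card (Block i ` S)" using assms(3) by (intro card_mono) auto
  also have "\<dots> \<le> card S" by (rule card_image_le[OF assms(3)])
  finally show ?thesis
    using card_image[OF inj_on_subset[OF embeds_inj_on[OF assms(1)] assms(2)]] by simp
qed

end

section \<open>Patterns without sum cut\<close>

text \<open>With negated first ranks this becomes the analogue for skew sums, where \<open>P\<close>
  lies to the lower right of \<open>Q\<close>.\<close>

definition sum_cut :: "'a set \<Rightarrow> ('a \<Rightarrow> int) \<Rightarrow> ('a \<Rightarrow> int) \<Rightarrow> 'a \<Rightarrow> 'a set \<Rightarrow> 'a set \<Rightarrow> bool" where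
  "sum_cut A r1 r2 z P Q \<longleftrightarrow> z \<in> A \<and> P \<union> Q = A - {z} \<and> P \<noteq> {} \<and> Q \<noteq> {} \<and>
     (\<forall>a\<in>P. \<forall>b\<in>Q. r1 a < r1 b \<and> r2 a < r2 b)"

lemma (in simple_pattern) undefinable_if_no_sum_cut:
  assumes no_cut: "\<And>z P Q. \<not> sum_cut A r1 r2 z P Q"
  shows "undefinable A r1 r2"
proof -
  obtain L where L: "L \<in> A" "\<And>a. a \<in> A \<Longrightarrow> a \<noteq> L \<Longrightarrow> r1 L < r1 a" using least1 by blast
  obtain R where R: "R \<in> A" "\<And>a. a \<in> A \<Longrightarrow> a \<noteq> R \<Longrightarrow> r1 a < r1 R" using greatest1 by blast
  obtain B where B: "B \<in> A" "\<And>a. a \<in> A \<Longrightarrow> a \<noteq> B \<Longrightarrow> r2 B < r2 a" using least2 by blast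
  obtain T where T: "T \<in> A" "\<And>a. a \<in> A \<Longrightarrow> a \<noteq> T \<Longrightarrow> r2 a < r2 T" using greatest2 by blast
  have ne: "L \<noteq> T" "L \<noteq> B" "T \<noteq> R" "R \<noteq> B"
    using no_corner[of L] no_corner[of R] L R B T by blast+
  have neq1: "r1 a \<noteq> r1 b" "r2 a \<noteq> r2 b" if "a \<in> A" "b \<in> A" "a \<noteq> b" for a b
    using that inj1 inj2 by (auto simp: inj_on_def)
  have le_iff: "r1 a \<le> r1 b \<longleftrightarrow> r1 a < r1 b" "r2 a \<le> r2 b \<longleftrightarrow> r2 a < r2 b"
    if "a \<in> A" "b \<in> A" "a \<noteq> b" for a b
    using neq1[OF that] by auto
  \<comment> \<open>\<open>Link i\<close> plays \<open>T\<close> in copy \<open>i\<close> and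
    \<open>L\<close> in copy \<open>i + 1\<close>; \<open>Ref\<close> plays \<open>R\<close> in copy
    0 and \<open>B\<close> in the last copy. The blocks lack exactly the points so played.\<close>
  interpret chain A r1 r2 "A - {T, R}" "A - {L, T}" "A - {L, B}" "{}" "{}" 0 "Suc 0" T L B R L
    by unfold_locales (use L T in auto)
  have card_minus: "card (A - {x, y}) + 2 = card A" if "x \<in> A" "y \<in> A" "x \<noteq> y" for x y
    using that card4 fin by (subst card_Diff_subset) auto
  have card_avail: "card (A - {T, R}) + 2 = card A" "card (A - {L, T}) + 2 = card A" "card (A - {L, B}) + 2 = card A"
    using card_minus L R B T ne by auto
  have cut: "(\<forall>a\<in>A - {z}. P a) \<or> (\<forall>a\<in>A - {z}. \<not> P a)"
    if "z \<in> A" "\<And>a b. a \<in> A \<Longrightarrow> b \<in> A \<Longrightarrow> a \<noteq> z \<Longrightarrow> b \<noteq> z \<Longrightarrow> P a \<Longrightarrow> \<not> P b \<Longrightarrow> r1 a < r1 b \<and> r2 a < r2 b"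
    for z and P :: "'a \<Rightarrow> bool"
    using no_cut[of z "{a\<in>A - {z}. P a}" "{a\<in>A - {z}. \<not> P a}"] that unfolding sum_cut_def by blast
  \<comment> \<open>As \<open>n\<close> is even, both end links are True and \<open>Ref\<close> is
    False.\<close>
  have even_proper: "proper n c" if n: "even n" and c: "c = (\<lambda>s. case s of Link i \<Rightarrow> even i | _ \<Rightarrow> False)"
    for n and c :: "'a site \<Rightarrow> bool"
    unfolding proper_def
  proof (intro allI impI, rule ccontr)
    fix g
    assume g: "embeds A r1 r2 (Collect (site n)) (key1 n) (key2 n) g"
      and "\<not> (\<exists>a\<in>A. \<exists>b\<in>A. free n (g a) \<and> free n (g b) \<and> c (g a) \<noteq> c (g b))"
    then have mono: "free n (g a) \<Longrightarrow> free n (g b) \<Longrightarrow> c (g a) = c (g b)" if "a \<in> A" "b \<in> A" for a b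
      using that by blast
    have site: "site n (g a)" if "a \<in> A" for a using g that by (auto simp: embeds_def)
    have lt1: "r1 a < r1 b" if "a \<in> A" "b \<in> A" "key1 n (g a) < key1 n (g b)" for a b
      using g that by (auto simp: embeds_def)
    have lt2: "r2 a < r2 b" if "a \<in> A" "b \<in> A" "key2 n (g a) < key2 n (g b)" for a b
      using g that by (auto simp: embeds_def)
    have inj: "g a \<noteq> g b" if "a \<in> A" "b \<in> A" "a \<noteq> b" for a b
      using embeds_inj_on[OF g] that by (auto simp: inj_on_def)
    \<comment> \<open>Every block lacks two points of the pattern, so it cannot hold all but one of
      them.\<close>
    have block: False if X: "X \<subseteq> A" "card A \<le> card X + 1" "\<And>a. a \<in> X \<Longrightarrow> \<exists>u. g a = Block i u" for X i
    proof -
      define S where "S = (if i = 0 then A - {T, R} else if i \<le> n then A - {L, T} else A - {L, B})"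
      have "card X \<le> card S"
      proof (rule card_block_le[OF g X(1)])
        fix a assume a: "a \<in> X"
        then obtain u where "g a = Block i u" using X(3) by blast
        moreover have "site n (g a)" using site a X(1) by blast
        ultimately show "\<exists>u\<in>S. g a = Block i u" by (auto simp: S_def)
      qed (use fin in \<open>auto simp: S_def\<close>)
      moreover have "card S + 2 = card A" using card_avail by (simp add: S_def)
      ultimately show False using X(2) by simp
    qed
    show False
    proof (cases "\<exists>y\<in>A. g y = Ref")
      case True
      then obtain y where y: "y \<in> A" "g y = Ref" by blast
      \<comment> \<open>A link with the colour of \<open>Ref\<close> has odd index, so it is neither
        end link. Hence the copy without \<open>y\<close> splits after index 0 and after index
        \<open>n\<close>.\<close>
      have link: "0 < i \<and> i < n" if "a \<in> A" "g a = Link i" for a i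
      proof -
        have "odd i" "i \<le> n" using mono[of a y] y that c site[of a] by auto
        then show ?thesis using n by (cases "i = n") (auto intro: odd_pos)
      qed
      have noRef: "g a \<noteq> Ref" if "a \<in> A" "a \<noteq> y" for a using inj[of a y] that y by auto
      have pos_lt: "r1 a < r1 b \<and> r2 a < r2 b"
        if "a \<in> A" "b \<in> A" "a \<noteq> y" "b \<noteq> y" "m = 0 \<or> m = n" "pos (g a) \<le> m" "\<not> pos (g b) \<le> m" for a b m
        using that site[of a] site[of b] link[of a] link[of b] noRef[of a] noRef[of b] n
        by (intro conjI lt1 lt2; cases "g a"; cases "g b") auto
      have dich: "(\<forall>a\<in>A - {y}. pos (g a) \<le> m) \<or> (\<forall>a\<in>A - {y}. \<not> pos (g a) \<le> m)"
        if "m = 0 \<or> m = n" for m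
        by (rule cut[OF y(1)]) (rule pos_lt[OF _ _ _ _ that])
      consider "\<forall>a\<in>A - {y}. pos (g a) \<le> 0"
        | "\<forall>a\<in>A - {y}. \<not> pos (g a) \<le> 0 \<and> pos (g a) \<le> n"
        | "\<forall>a\<in>A - {y}. \<not> pos (g a) \<le> n"
        using dich[of 0] dich[of n] by blast
      then show False
      proof cases
        case 1
        have "\<exists>u. g a = Block 0 u" if "a \<in> A - {y}" for a
          using that 1 noRef[of a] link[of a] by (cases "g a") force+
        then show False using block[of "A - {y}" 0] y fin card4 by simp
      next
        case 2
        \<comment> \<open>All other points are in the middle of the chain, so \<open>Ref\<close> is
          a lower right corner of the copy.\<close>
        have "r1 a < r1 y \<and> r2 y < r2 a" if "a \<in> A - {y}" for a
          using that 2 noRef[of a] link[of a] y n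
          by (intro conjI lt1 lt2; cases "g a") (force simp: le_less)+
        then show False using no_corner[OF y(1)] by blast
      next
        case 3
        have "\<exists>u. g a = Block (n + 1) u" if "a \<in> A - {y}" for a
          using that 3 noRef[of a] site[of a] by (cases "g a") force+
        then show False using block[of "A - {y}" "n + 1"] y fin card4 by simp
      qed
    next
      case False
      then have noRef: "g a \<noteq> Ref" if "a \<in> A" for a using that by blast
      show False
      proof (cases "\<exists>z\<in>A. \<exists>i. g z = Link i")
        case True
        then obtain z i where z: "z \<in> A" "g z = Link i" by blast
        have par: "even j = even i" if "a \<in> A" "g a = Link j" for a j
          using mono[of a z] z that c by auto
        have noi: "g a \<noteq> Link i" if "a \<in> A" "a \<noteq> z" for a using inj[of a z] that z by auto
        \<comment> \<open>Equal parity excludes \<open>Link (i - 1)\<close> and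
          \<open>Link (i + 1)\<close>, which would hinder a split just below index \<open>i\<close>
          or just above \<open>i + 1\<close>.\<close>
        have noSuc: "g a \<noteq> Link (Suc i)" "g a = Link k \<Longrightarrow> Suc k \<noteq> i" if "a \<in> A" for a k
          using par[of a] that by auto
        have cmp: "r1 a < r1 b \<and> r2 a < r2 b"
          if "a \<in> A" "b \<in> A" "a \<noteq> z" "b \<noteq> z" "pos (g a) \<le> i" "\<not> pos (g b) \<le> i" for a b
          using that noRef[of a] noRef[of b] noi[of a] noSuc[of a] noSuc[of b]
          by (intro conjI lt1 lt2; cases "g a"; cases "g b") (auto simp: less_Suc_eq_le le_less)
        have "(\<forall>a\<in>A - {z}. pos (g a) \<le> i) \<or> (\<forall>a\<in>A - {z}. \<not> pos (g a) \<le> i)"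
          by (rule cut[OF z(1)]) (rule cmp)
        then consider "\<forall>a\<in>A - {z}. pos (g a) \<le> i" | "\<forall>a\<in>A - {z}. \<not> pos (g a) \<le> i" by blast
        then show False
        proof cases
          case 1
          \<comment> \<open>A second split, this time of the whole copy including \<open>z\<close>,
            pushes the other points into block \<open>i\<close>.\<close>
          have "r1 a < r1 b \<and> r2 a < r2 b"
            if "a \<in> A" "b \<in> A" "pos (g a) < i" "\<not> pos (g b) < i" for a b
            using that noRef[of a] noRef[of b] noi[of a] noSuc[of a] noSuc[of b]
            by (intro conjI lt1 lt2; cases "g a"; cases "g b") (auto simp: less_Suc_eq_le le_less)
          then have "(\<forall>a\<in>A. pos (g a) < i) \<or> (\<forall>a\<in>A. \<not> pos (g a) < i)"
            by (rule sum_indecomposable)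
          then have "\<forall>a\<in>A. \<not> pos (g a) < i" using z by auto
          then have "pos (g a) = i" if "a \<in> A - {z}" for a using that 1 by force
          then have "\<exists>u. g a = Block i u" if "a \<in> A - {z}" for a
            using that noRef[of a] noi[of a] by (cases "g a") force+
          then show False using block[of "A - {z}" i] z fin card4 by simp
        next
          case 2
          have "r1 a < r1 b \<and> r2 a < r2 b"
            if "a \<in> A" "b \<in> A" "pos (g a) \<le> Suc i" "\<not> pos (g b) \<le> Suc i" for a b
            using that noRef[of a] noRef[of b] noSuc[of a] noSuc[of b] 2 z
            by (intro conjI lt1 lt2; cases "g a"; cases "g b"; cases "a = z") (auto simp: less_Suc_eq_le le_less)
          then have "(\<forall>a\<in>A. pos (g a) \<le> Suc i) \<or> (\<forall>a\<in>A. \<not> pos (g a) \<le> Suc i)"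
            by (rule sum_indecomposable)
          then have "\<forall>a\<in>A. pos (g a) \<le> Suc i" using z by auto
          then have "pos (g a) = Suc i" if "a \<in> A - {z}" for a using that 2 by force
          then have "\<exists>u. g a = Block (Suc i) u" if "a \<in> A - {z}" for a
            using that noRef[of a] noSuc[of a] by (cases "g a") force+
          then show False using block[of "A - {z}" "Suc i"] z fin card4 by simp
        qed
      next
        case False
        then have blocks: "\<exists>i u. g a = Block i u" if "a \<in> A" for a
          using that noRef[of a] by (cases "g a") auto
        obtain z where z: "z \<in> A" using nonempty by blast
        define i where "i = pos (g z)"
        have lt: "r1 a < r1 b \<and> r2 a < r2 b" if "a \<in> A" "b \<in> A" "pos (g a) < pos (g b)" for a b
          using that blocks[of a] blocks[of b] by (intro conjI lt1 lt2) auto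
        have "(\<forall>a\<in>A. pos (g a) < i) \<or> (\<forall>a\<in>A. \<not> pos (g a) < i)"
          by (rule sum_indecomposable) (use lt in auto)
        moreover have "(\<forall>a\<in>A. pos (g a) \<le> i) \<or> (\<forall>a\<in>A. \<not> pos (g a) \<le> i)"
          by (rule sum_indecomposable) (use lt in auto)
        ultimately have eq: "pos (g a) = i" if "a \<in> A" for a
          using z that unfolding i_def by (meson antisym not_le order_refl order_less_irrefl)
        have "\<exists>u. g a = Block i u" if "a \<in> A" for a
          using that blocks[of a] eq[of a] by auto
        then show False using block[of A i] by simp
      qed
    qed
  qed
  have odd_not_proper: "\<not> proper n c" if n: "odd n" for n c
  proof
    assume p: "proper n c"
    have emb: "\<exists>a\<in>A. \<exists>b\<in>A. free n (g a) \<and> free n (g b) \<and> c (g a) \<noteq> c (g b)"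
      if "embeds A r1 r2 (Collect (site n)) (key1 n) (key2 n) g" for g
      using p that by (auto simp: proper_def)
    have "c (Link i) \<noteq> c (Link (Suc i))" if i: "i < n" for i
    proof -
      have "embeds A r1 r2 (Collect (site n)) (key1 n) (key2 n)
          (\<lambda>a. if a = L then Link i else if a = T then Link (Suc i) else Block (Suc i) a)"
        using i L T ne by (auto simp: embeds_def not_less double_shift le_iff intro: less_imp_le dest: less_not_sym)
      from emb[OF this] i show ?thesis by (auto split: if_splits)
    qed
    then have "c (Link n) = (c (Link 0) = even n)" by (rule links_alternate) auto
    moreover have "c (Link 0) \<noteq> c Ref"
    proof -
      have "embeds A r1 r2 (Collect (site n)) (key1 n) (key2 n)
          (\<lambda>a. if a = T then Link 0 else if a = R then Ref else Block 0 a)"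
        using R T ne neq1 by (auto simp: embeds_def not_less double_shift le_iff intro: less_imp_le dest: less_not_sym)
      from emb[OF this] show ?thesis by (auto split: if_splits)
    qed
    moreover have "c (Link n) \<noteq> c Ref"
    proof -
      have "embeds A r1 r2 (Collect (site n)) (key1 n) (key2 n)
          (\<lambda>a. if a = L then Link n else if a = B then Ref else Block (n + 1) a)"
        using L B ne neq1 by (auto simp: embeds_def not_less double_shift le_iff intro: less_imp_le dest: less_not_sym)
      from emb[OF this] show ?thesis by (auto split: if_splits)
    qed
    ultimately show False using n by auto
  qed
  show ?thesis
    by (rule undefinable_if_parity) (use even_proper odd_not_proper in blast)+
qed

section \<open>Patterns with a nearly corner maximum\<close>

text \<open>Such a pattern escapes the previous argument, also after reversal: deleting
  \<open>T\<close> leaves a sum with last summand \<open>R\<close>, and deleting \<open>L\<close>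
  leaves a skew sum with first summand \<open>T\<close>.\<close>

lemma (in simple_pattern) undefinable_if_nearly_top_left:
  assumes LTR: "L \<in> A" "T \<in> A" "R \<in> A" "L \<noteq> T" "T \<noteq> R" "L \<noteq> R"
    and L1: "r1 L < r1 T" and T1: "\<And>a. a \<in> A \<Longrightarrow> a \<noteq> L \<Longrightarrow> a \<noteq> T \<Longrightarrow> r1 T < r1 a"
    and T2: "\<And>a. a \<in> A \<Longrightarrow> a \<noteq> T \<Longrightarrow> r2 a < r2 T"
    and R1: "\<And>a. a \<in> A \<Longrightarrow> a \<noteq> R \<Longrightarrow> r1 a < r1 R"
    and R2: "\<And>a. a \<in> A \<Longrightarrow> a \<noteq> T \<Longrightarrow> a \<noteq> R \<Longrightarrow> r2 a < r2 R"
  shows "undefinable A r1 r2"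
proof -
  obtain B where B: "B \<in> A" "\<And>a. a \<in> A \<Longrightarrow> a \<noteq> B \<Longrightarrow> r2 B < r2 a" using least2 by blast
  have L1': "r1 L < r1 a" if "a \<in> A" "a \<noteq> L" for a
    using that L1 T1[of a] by (cases "a = T") auto
  have ne: "L \<noteq> B" "T \<noteq> B" "R \<noteq> B"
  proof -
    show "L \<noteq> B" using no_corner[of L] L1' B by blast
    show "R \<noteq> B" using no_corner[of R] R1 B by blast
    show "T \<noteq> B" using B(2)[of L] T2[of L] LTR by auto
  qed
  have neq: "r1 a \<noteq> r1 b" "r2 a \<noteq> r2 b" if "a \<in> A" "b \<in> A" "a \<noteq> b" for a b
    using that inj1 inj2 by (auto simp: inj_on_def)
  have le_iff: "r1 a \<le> r1 b \<longleftrightarrow> r1 a < r1 b" "r2 a \<le> r2 b \<longleftrightarrow> r2 a < r2 b"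
    if "a \<in> A" "b \<in> A" "a \<noteq> b" for a b
    using neq[OF that] by auto
  \<comment> \<open>\<open>Link i\<close> plays \<open>R\<close> in copy \<open>i\<close> and
    \<open>B\<close> in copy \<open>i + 1\<close>. In copy 0 both \<open>Link 0\<close> and
    \<open>Ref\<close> can play \<open>R\<close>, in the last copy both \<open>Link n\<close> and
    \<open>Ref\<close> can play \<open>B\<close>; each time the free point at \<open>T\<close> must
    differ from both candidates, so these agree.\<close>
  interpret chain A r1 r2 "A - {R}" "A - {B, R}" "A - {B}" "{T}" "{T}" "Suc 0" 0 B R B R T
    by unfold_locales (use LTR B in auto)
  \<comment> \<open>The end links and \<open>Ref\<close> are True, the free points at
    \<open>T\<close> False.\<close>
  have even_proper: "proper n c" if n: "even n" and c: "c = (\<lambda>s. case s of Link i \<Rightarrow> even i | Ref \<Rightarrow> True | _ \<Rightarrow> False)"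
    for n and c :: "'a site \<Rightarrow> bool"
    unfolding proper_def
  proof (intro allI impI, rule ccontr)
    fix g
    assume g: "embeds A r1 r2 (Collect (site n)) (key1 n) (key2 n) g"
      and "\<not> (\<exists>a\<in>A. \<exists>b\<in>A. free n (g a) \<and> free n (g b) \<and> c (g a) \<noteq> c (g b))"
    then have mono: "free n (g a) \<Longrightarrow> free n (g b) \<Longrightarrow> c (g a) = c (g b)" if "a \<in> A" "b \<in> A" for a b
      using that by blast
    have site: "site n (g a)" if "a \<in> A" for a using g that by (auto simp: embeds_def)
    have lt1: "r1 a < r1 b" if "a \<in> A" "b \<in> A" "key1 n (g a) < key1 n (g b)" for a b
      using g that by (auto simp: embeds_def)
    have lt2: "r2 a < r2 b" if "a \<in> A" "b \<in> A" "key2 n (g a) < key2 n (g b)" for a b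
      using g that by (auto simp: embeds_def)
    have lt1': "key1 n (g a) < key1 n (g b)" if "a \<in> A" "b \<in> A" "r1 a < r1 b" for a b
      using g that by (auto simp: embeds_def)
    have lt2': "key2 n (g a) < key2 n (g b)" if "a \<in> A" "b \<in> A" "r2 a < r2 b" for a b
      using g that by (auto simp: embeds_def)
    have inj: "inj_on g A" by (rule embeds_inj_on[OF g])
    have injD: "g a \<noteq> g b" if "a \<in> A" "b \<in> A" "a \<noteq> b" for a b
      using inj that by (auto simp: inj_on_def)
    have R_after: "key1 n (g a) < key1 n (g R)" if "a \<in> A" "a \<noteq> R" for a
      using lt1'[of a R] R1[of a] that LTR by blast
    have T_above: "key2 n (g a) < key2 n (g T)" if "a \<in> A" "a \<noteq> T" for a
      using lt2'[of a T] T2[of a] that LTR by blast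
    have before_T: "a = L" if "a \<in> A" "key1 n (g a) < key1 n (g T)" for a
      using lt1[OF that(1) LTR(2) that(2)] T1[of a] that(1) by fastforce
    have above_R: "a = T" if "a \<in> A" "key2 n (g R) < key2 n (g a)" for a
      using lt2[OF LTR(3) that(1) that(2)] R2[of a] that(1) by fastforce
    show False
    proof (cases "\<exists>y\<in>A. g y = Ref")
      case True
      then obtain y where y: "y \<in> A" "g y = Ref" by blast
      have red: "c (g a)" if "a \<in> A" "free n (g a)" for a
        using mono[OF that(1) y(1) that(2)] y c by auto
      have noT: "g a \<noteq> Block 0 T" "g a \<noteq> Block (Suc n) T" if "a \<in> A" for a
        using red[OF that] c by auto
      have noRef: "g a \<noteq> Ref" if "a \<in> A" "a \<noteq> y" for a using injD[of a y] that y by auto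
      \<comment> \<open>The free place \<open>T\<close> is the only one of block 0 above
        \<open>Ref\<close>, and its colour excludes it here. So the points in block 0 would be a
        lower left summand.\<close>
      have "r1 a < r1 b \<and> r2 a < r2 b"
        if ab: "a \<in> A" "b \<in> A" "\<exists>u. g a = Block 0 u" "\<not> (\<exists>u. g b = Block 0 u)" for a b
      proof -
        obtain u where u: "g a = Block 0 u" using ab by blast
        then have "u \<in> A" "u \<noteq> R" "u \<noteq> T" using site[of a] noT[of a] ab by auto
        then have "r2 u < r2 R" using R2 by blast
        then show ?thesis using ab u site[of b]
          by (intro conjI lt1 lt2; cases "g b") (auto simp: double_shift)
      qed
      then have "(\<forall>a\<in>A. \<exists>u. g a = Block 0 u) \<or> (\<forall>a\<in>A. \<not> (\<exists>u. g a = Block 0 u))"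
        by (rule sum_indecomposable)
      then have no0: "g a \<noteq> Block 0 u" if "a \<in> A" for a u
        using y that by auto
      define Q where "Q = {a\<in>A. \<exists>u. g a = Block (Suc n) u}"
      have y_low: "r2 y < r2 a" if "a \<in> A" "a \<noteq> y" for a
        using that site[of a] noRef[of a] no0[of a] y
        by (intro lt2; cases "g a") auto
      have "y \<noteq> R" using no_corner[of R] R1 y_low LTR by blast
      \<comment> \<open>Only sites of the last block lie to the right of \<open>Ref\<close>, and
        only sites of that block lie above one of its sites.\<close>
      have "R \<in> Q"
        using R_after[OF y(1) \<open>y \<noteq> R\<close>] y site[of R] LTR by (cases "g R") (auto simp: Q_def)
      then obtain uR where uR: "g R = Block (Suc n) uR" by (auto simp: Q_def)
      have "T \<in> Q"
        using T_above[of R] uR LTR site[of T] by (cases "g T") (auto simp: Q_def)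
      then obtain uT where uT: "g T = Block (Suc n) uT" by (auto simp: Q_def)
      have u_range: "u \<in> A - {B, T, R}" if "a \<in> A" "g a = Block (Suc n) u" for a u
      proof -
        have u: "u \<in> A" "u \<noteq> B" "u \<noteq> T" using site[of a] noT[of a] that by auto
        \<comment> \<open>With the place \<open>T\<close> excluded, a point at the place
          \<open>R\<close> of the last block would be the upper right corner of the copy.\<close>
        moreover have "u \<noteq> R"
        proof
          assume "u = R"
          have "r1 b < r1 a \<and> r2 b < r2 a" if b: "b \<in> A" "b \<noteq> a" for b
          proof (cases "g b")
            case (Block i v)
            then have "i \<le> n \<or> i = Suc n \<and> v \<in> A \<and> v \<noteq> T \<and> v \<noteq> R"
              using site[of b] noT[of b] b injD[of a b] \<open>a \<in> A\<close> \<open>g a = Block (Suc n) u\<close> \<open>u = R\<close> by auto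
            then show ?thesis
              using Block b \<open>a \<in> A\<close> \<open>g a = Block (Suc n) u\<close> \<open>u = R\<close> R1[of v] R2[of v]
              by (intro conjI lt1 lt2) auto
          next
            case (Link i)
            then show ?thesis
              using site[of b] b \<open>a \<in> A\<close> \<open>g a = Block (Suc n) u\<close> \<open>u = R\<close> R1[OF B(1)] ne
              by (intro conjI lt1 lt2) auto
          next
            case Ref
            then show ?thesis
              using b \<open>a \<in> A\<close> \<open>g a = Block (Suc n) u\<close> \<open>u = R\<close> R1[OF B(1)] ne
              by (intro conjI lt1 lt2) (auto simp: double_shift)
          qed
          then show False using no_corner[OF \<open>a \<in> A\<close>] by blast
        qed
        ultimately show ?thesis by blast
      qed
      have card3: "card (A - {B, T, R}) + 3 = card A"
        using LTR B ne card4 fin by (subst card_Diff_subset) auto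
      have finQ: "finite Q" using fin by (auto simp: Q_def)
      define I where "I = {u. \<exists>a\<in>A. g a = Block (Suc n) u}"
      have I: "I \<subseteq> A - {B, T, R}" using u_range unfolding I_def by blast
      have "g ` Q = Block (Suc n) ` I" by (force simp: Q_def I_def image_iff)
      moreover have "card (g ` Q) = card Q"
        by (rule card_image) (rule inj_on_subset[OF inj], auto simp: Q_def)
      moreover have "card (Block (Suc n) ` I) = card I"
        by (rule card_image) (auto simp: inj_on_def)
      ultimately have cardQ: "card Q = card I" by simp
      define Z where "Z = {a\<in>A. g a = Link n}"
      have "a = b" if "a \<in> Z" "b \<in> Z" for a b
        using injD[of a b] that by (auto simp: Z_def)
      moreover have finZ: "finite Z" using fin by (simp add: Z_def)
      ultimately have cardZ: "card Z \<le> 1" by (simp add: card_le_Suc0_iff_eq)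
      \<comment> \<open>A site with first index at most \<open>n\<close> precedes the image of
        \<open>T\<close>, so only \<open>L\<close> can be there. Outside the last block there is
        thus room for three points, at \<open>Link n\<close>, at \<open>Ref\<close> and for
        \<open>L\<close>; hence all \<open>card A - 3\<close> usable places of that block are
        taken.\<close>
      have cover: "A \<subseteq> Q \<union> Z \<union> {y, L}"
      proof
        fix a assume a: "a \<in> A"
        show "a \<in> Q \<union> Z \<union> {y, L}"
        proof (rule ccontr)
          assume neg: "a \<notin> Q \<union> Z \<union> {y, L}"
          then have "fst (key1 n (g a)) \<le> n"
            using a site[of a] noRef[of a] by (cases "g a") (auto simp: Q_def Z_def)
          then have "key1 n (g a) < key1 n (g T)" using uT by (cases "key1 n (g a)") auto
          then show False using before_T[OF a] neg by blast
        qed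
      qed
      have "card A \<le> card (Q \<union> Z \<union> {y, L})"
        using cover finQ finZ by (intro card_mono) auto
      also have "\<dots> \<le> card (Q \<union> Z) + card {y, L}" by (rule card_Un_le)
      also have "\<dots> \<le> card Q + card Z + 2"
        using card_Un_le[of Q Z] by (simp add: card_insert_if)
      finally have "card A \<le> card Q + 3" using cardZ by simp
      moreover have "card I \<le> card (A - {B, T, R})" using I fin by (intro card_mono) auto
      ultimately have "card I = card (A - {B, T, R})" using card3 cardQ by simp
      then have IS: "I = A - {B, T, R}" using I fin by (intro card_subset_eq) auto
      have "L \<notin> Q"
      proof
        assume "L \<in> Q"
        then have "Q \<union> Z \<union> {y, L} = Q \<union> Z \<union> {y}" by blast
        then have "card A \<le> card (Q \<union> Z \<union> {y})"
          using cover finQ finZ by (intro card_mono) auto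
        also have "\<dots> \<le> card (Q \<union> Z) + card {y}" by (rule card_Un_le)
        also have "\<dots> \<le> card Q + card Z + 1" using card_Un_le[of Q Z] by simp
        finally have "card A \<le> card Q + 2" using cardZ by simp
        moreover have "card I \<le> card (A - {B, T, R})" using I fin by (intro card_mono) auto
        ultimately show False using card3 cardQ by simp
      qed
      have "L \<in> I" using IS LTR ne by simp
      then obtain l where l: "l \<in> A" "g l = Block (Suc n) L" by (auto simp: I_def)
      \<comment> \<open>The place \<open>L\<close> is the leftmost of the block, and
        \<open>T\<close> precedes every point of the pattern except \<open>L\<close>, which is not
        in this block.\<close>
      have "l = T"
      proof (rule ccontr)
        assume "l \<noteq> T"
        have "l \<noteq> L" using \<open>L \<notin> Q\<close> l by (auto simp: Q_def)
        then have "key1 n (g T) < key1 n (g l)" using T1[of l] lt1'[of T l] l \<open>l \<noteq> T\<close> LTR by blast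
        moreover have "\<not> r1 uT < r1 L" using L1'[of uT] u_range[OF LTR(2) uT] by (cases "uT = L") auto
        ultimately show False using uT l by simp
      qed
      then have gT: "g T = Block (Suc n) L" using l by simp
      \<comment> \<open>The topmost point sits at the place \<open>L\<close>, so all other places
        taken are lower. This makes \<open>A - {T, R, L}\<close> an interval, so
        \<open>card A = 4\<close>, and a single place is left for both \<open>T\<close> and
        \<open>R\<close>.\<close>
      have below_L: "r2 u < r2 L" if u: "u \<in> A - {T, R, L}" for u
      proof (cases "u = B")
        case True
        then show ?thesis using B(2)[of L] LTR ne by blast
      next
        case False
        then have "u \<in> I" using u IS by blast
        then obtain a where a: "a \<in> A" "g a = Block (Suc n) u" by (auto simp: I_def)
        then have "a \<noteq> T" using gT u by auto
        from T_above[OF a(1) this] show ?thesis using gT a by simp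
      qed
      have "card (A - {T, R, L}) \<le> 1"
      proof (rule interval_trivial)
        fix p a b assume h: "p \<in> A" "p \<notin> A - {T, R, L}" "a \<in> A - {T, R, L}" "b \<in> A - {T, R, L}"
        have "r1 L < r1 a" "r1 T < r1 a" "r1 b < r1 R" "r2 b < r2 L" "r2 b < r2 T" "r2 b < r2 R"
          using h L1'[of a] T1[of a] R1[of b] below_L[of b] T2[of b] R2[of b] by auto
        then show "\<not> (r1 a < r1 p \<and> r1 p < r1 b) \<and> \<not> (r2 a < r2 p \<and> r2 p < r2 b)"
          using h by auto
      qed (use LTR in auto)
      moreover have "card (A - {T, R, L}) + 3 = card A"
        using LTR card4 fin by (subst card_Diff_subset) auto
      moreover have "card {T, R} \<le> card Q"
        using \<open>R \<in> Q\<close> \<open>T \<in> Q\<close> finQ by (intro card_mono) auto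
      moreover have "card Q \<le> card (A - {B, T, R})" using cardQ I fin by (simp add: card_mono)
      ultimately show False using card3 LTR(5) by simp
    next
      case False
      then have noRef: "g a \<noteq> Ref" if "a \<in> A" for a using that by blast
      show False
      proof (cases "\<exists>z\<in>A. \<exists>i. g z = Link i")
        case True
        then obtain z i where z: "z \<in> A" "g z = Link i" by blast
        have iN: "i \<le> n" using site[OF z(1)] z(2) by simp
        have par: "even j = even i" if "a \<in> A" "g a = Link j" for a j
          using mono[of a z] z that c by auto
        have noi: "g a \<noteq> Link i" if "a \<in> A" "a \<noteq> z" for a using injD[of a z] that z by auto
        have noSuc: "g a \<noteq> Link (Suc i)" "g a = Link k \<Longrightarrow> Suc k \<noteq> i" if "a \<in> A" for a k
          using par[of a] that by auto
        have noT: "g a \<noteq> Block 0 T" "g a \<noteq> Block (Suc n) T" if "even i" "a \<in> A" for a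
          using mono[of a z] that z c by auto
        have "r1 a < r1 b \<and> r2 a < r2 b"
          if "a \<in> A" "b \<in> A" "pos (g a) < i" "\<not> pos (g b) < i" for a b
          using that noRef[of a] noRef[of b] noi[of a] noSuc[of a] noSuc[of b]
          by (intro conjI lt1 lt2; cases "g a"; cases "g b") (auto simp: less_Suc_eq_le le_less)
        then have "(\<forall>a\<in>A. pos (g a) < i) \<or> (\<forall>a\<in>A. \<not> pos (g a) < i)"
          by (rule sum_indecomposable)
        then have lower: "\<forall>a\<in>A. \<not> pos (g a) < i" using z by auto
        have "r1 a < r1 b \<and> r2 a < r2 b"
          if "a \<in> A" "b \<in> A" "pos (g a) \<le> Suc i" "\<not> pos (g b) \<le> Suc i" for a b
          using that noRef[of a] noRef[of b] noSuc[of a] noSuc[of b]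
          by (intro conjI lt1 lt2; cases "g a"; cases "g b") (auto simp: le_Suc_eq less_Suc_eq_le le_less)
        then have "(\<forall>a\<in>A. pos (g a) \<le> Suc i) \<or> (\<forall>a\<in>A. \<not> pos (g a) \<le> Suc i)"
          by (rule sum_indecomposable)
        then have upper: "\<forall>a\<in>A. pos (g a) \<le> Suc i" using z by auto
        \<comment> \<open>By the two splits the copy is confined to \<open>Link i\<close> and the
          two blocks that it joins.\<close>
        define P where "P = {a\<in>A. \<exists>u. g a = Block i u}"
        define Q where "Q = {a\<in>A. \<exists>u. g a = Block (Suc i) u}"
        have cover: "a = z \<or> a \<in> P \<or> a \<in> Q" if a: "a \<in> A" for a
        proof -
          have "pos (g a) = i \<or> pos (g a) = Suc i" using lower upper a by force
          then show ?thesis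
            using a noRef[of a] noi[of a] noSuc[of a] by (cases "g a") (auto simp: P_def Q_def)
        qed
        \<comment> \<open>For \<open>i = n\<close> the block has the place \<open>R\<close>, but
          \<open>i\<close> is then even and the free place \<open>T\<close> has the wrong colour;
          either way two places are missing.\<close>
        define S where "S = (if i = n then A - {B, T} else A - {B, R})"
        have cardS: "card S + 2 = card A"
          using LTR B ne card4 fin by (simp add: S_def card_Diff_subset)
        have QS: "u \<in> S" if "a \<in> A" "g a = Block (Suc i) u" for a u
          using site[of a] noT[of a] that n iN by (auto simp: S_def)
        have cardQ: "card Q \<le> card S"
        proof (rule card_block_le[OF g])
          show "finite S" using fin by (simp add: S_def)
          fix a assume "a \<in> Q"
          then show "\<exists>u\<in>S. g a = Block (Suc i) u" using QS unfolding Q_def by blast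
        qed (auto simp: Q_def)
        have fin': "finite P" "finite Q" using fin by (auto simp: P_def Q_def)
        have "card A \<le> card (P \<union> Q \<union> {z})" using cover fin' by (intro card_mono) auto
        also have "\<dots> \<le> card (P \<union> Q) + card {z}" by (rule card_Un_le)
        also have "\<dots> \<le> card P + card Q + 1" using card_Un_le[of P Q] by simp
        finally have cardA: "card A \<le> card P + card Q + 1" .
        then have "P \<noteq> {}" using cardQ cardS by auto
        \<comment> \<open>In block 0 the place \<open>T\<close> is excluded by its colour, and all
          other places are to the lower left of \<open>Link 0\<close>; so \<open>P\<close> would be
          a proper summand.\<close>
        have i0: "i \<noteq> 0"
        proof
          assume "i = 0"
          have "r1 a < r1 b \<and> r2 a < r2 b" if ab: "a \<in> A" "b \<in> A" "a \<in> P" "\<not> b \<in> P" for a b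
          proof -
            obtain u where u: "g a = Block 0 u" using ab \<open>i = 0\<close> by (auto simp: P_def)
            then have "u \<in> A" "u \<noteq> R" "u \<noteq> T" using site[of a] noT[of a] ab \<open>i = 0\<close> by auto
            then have "r2 u < r2 R" using R2 by blast
            moreover have "b = z \<or> (\<exists>v. g b = Block (Suc 0) v)"
              using cover[OF ab(2)] ab(4) \<open>i = 0\<close> by (auto simp: Q_def)
            ultimately show ?thesis using ab u z \<open>i = 0\<close> by (intro conjI lt1 lt2) auto
          qed
          then have "(\<forall>a\<in>A. a \<in> P) \<or> (\<forall>a\<in>A. \<not> a \<in> P)" by (rule sum_indecomposable)
          then show False using z \<open>P \<noteq> {}\<close> by (auto simp: P_def)
        qed
        have cardP: "card P \<le> card (A - {B, R})"
        proof (rule card_block_le[OF g])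
          fix a assume "a \<in> P"
          then show "\<exists>u\<in>A - {B, R}. g a = Block i u" using site[of a] i0 iN by (auto simp: P_def)
        qed (use fin in \<open>auto simp: P_def\<close>)
        have "card (A - {B, R}) + 2 = card A"
          using LTR B ne card4 fin by (subst card_Diff_subset) auto
        with cardP cardA have "Q \<noteq> {}" by auto
        have PQ: "r1 a < r1 b \<and> r2 a < r2 b" if "a \<in> P" "b \<in> Q" for a b
          using that by (intro conjI lt1 lt2) (auto simp: P_def Q_def)
        have zQ: "r2 z < r2 b" if "b \<in> Q" for b
          using that z by (intro lt2) (auto simp: Q_def)
        have PA: "P \<subseteq> A" "Q \<subseteq> A" by (auto simp: P_def Q_def)
        \<comment> \<open>Otherwise \<open>R\<close> is at \<open>Link i\<close>, below and to the
          right of \<open>Q\<close>, so \<open>Q\<close> is an interval. Its only point, being above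
          \<open>R\<close>, is \<open>T\<close>, and only \<open>L\<close> is left for
          \<open>P\<close>, which is too few.\<close>
        have "R \<in> Q"
        proof (rule ccontr)
          assume "R \<notin> Q"
          moreover have "R \<notin> P"
          proof
            assume "R \<in> P"
            obtain q where "q \<in> Q" using \<open>Q \<noteq> {}\<close> by blast
            then show False using PQ[OF \<open>R \<in> P\<close>] R1[of q] PA \<open>R \<notin> Q\<close> by fastforce
          qed
          ultimately have "z = R" using cover LTR by blast
          have "card Q \<le> 1"
          proof (rule interval_trivial[OF PA(2)])
            show "Q \<noteq> A" using \<open>R \<notin> Q\<close> LTR by blast
            fix p a b assume h: "p \<in> A" "p \<notin> Q" "a \<in> Q" "b \<in> Q"
            have "p \<in> P \<or> p = R" using cover[OF h(1)] h \<open>z = R\<close> by blast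
            then show "\<not> (r1 a < r1 p \<and> r1 p < r1 b) \<and> \<not> (r2 a < r2 p \<and> r2 p < r2 b)"
            proof
              assume "p \<in> P"
              then show ?thesis using PQ[of p a] h by auto
            next
              assume "p = R"
              moreover have "r1 b < r1 R" using R1[of b] h PA(2) \<open>R \<notin> Q\<close> by blast
              ultimately show ?thesis using zQ[OF h(3)] \<open>z = R\<close> by auto
            qed
          qed
          then have "2 \<le> card P" using cardA card4 by simp
          obtain q where q: "q \<in> Q" using \<open>Q \<noteq> {}\<close> by blast
          then have "key2 n (g R) < key2 n (g q)" using z \<open>z = R\<close> by (auto simp: Q_def)
          then have "q = T" using above_R[of q] q PA by blast
          have "P \<subseteq> {L}"
          proof
            fix a assume a: "a \<in> P"
            then have "key1 n (g a) < key1 n (g T)" using q \<open>q = T\<close> by (auto simp: P_def Q_def)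
            then show "a \<in> {L}" using before_T[of a] a PA by blast
          qed
          then have "card P \<le> 1" using card_mono[of "{L}" P] by simp
          with \<open>2 \<le> card P\<close> show False by simp
        qed
        then obtain uR where uR: "g R = Block (Suc i) uR" by (auto simp: Q_def)
        have "T \<in> Q"
        proof -
          have "key2 n (Block (Suc i) uR) < key2 n (g T)" using T_above[of R] uR LTR by simp
          then show ?thesis using cover[OF LTR(2)] z LTR(2) by (auto simp: P_def)
        qed
        then obtain uT where uT: "g T = Block (Suc i) uT" by (auto simp: Q_def)
        have "P \<subseteq> {L}"
        proof
          fix a assume a: "a \<in> P"
          then have "key1 n (g a) < key1 n (g T)" using uT by (auto simp: P_def)
          then show "a \<in> {L}" using before_T[of a] a PA by blast
        qed
        with \<open>P \<noteq> {}\<close> have "P = {L}" by blast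
        then have "L \<in> P" by blast
        then have "L \<notin> Q" by (auto simp: P_def Q_def)
        define I where "I = {u. \<exists>a\<in>A. g a = Block (Suc i) u}"
        have I: "I \<subseteq> S" using QS unfolding I_def by blast
        have "g ` Q = Block (Suc i) ` I" by (force simp: Q_def I_def image_iff)
        moreover have "card (g ` Q) = card Q"
          by (rule card_image) (rule inj_on_subset[OF inj PA(2)])
        moreover have "card (Block (Suc i) ` I) = card I"
          by (rule card_image) (auto simp: inj_on_def)
        ultimately have "card I = card Q" by simp
        then have "card I = card S" using cardA cardS cardQ \<open>P = {L}\<close> by simp
        then have "I = S" using I fin by (intro card_subset_eq) (auto simp: S_def)
        have "L \<in> I" using \<open>I = S\<close> LTR ne by (simp add: S_def)
        then obtain l where l: "l \<in> A" "g l = Block (Suc i) L" by (auto simp: I_def)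
        have "l = T"
        proof (rule ccontr)
          assume "l \<noteq> T"
          have "l \<noteq> L" using \<open>L \<notin> Q\<close> l by (auto simp: Q_def)
          then have "key1 n (g T) < key1 n (g l)" using T1[of l] lt1'[of T l] l \<open>l \<noteq> T\<close> LTR by blast
          moreover have "uT \<in> A" using QS[OF LTR(2) uT] by (auto simp: S_def split: if_splits)
          then have "\<not> r1 uT < r1 L" using L1'[of uT] by (cases "uT = L") auto
          ultimately show False using uT l by simp
        qed
        then have gT: "g T = Block (Suc i) L" using l by simp
        \<comment> \<open>A place above \<open>L\<close> that is certainly taken: \<open>T\<close>
          is available except in the last block, where \<open>R\<close> is. It contradicts the
          topmost point being at \<open>L\<close>.\<close>
        define b where "b = (if i = n then R else T)"
        have b: "b \<in> I" "b \<noteq> L" "r2 L < r2 b"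
          using \<open>I = S\<close> LTR ne R2[of L] T2[of L] by (auto simp: b_def S_def)
        then obtain a where a: "a \<in> A" "g a = Block (Suc i) b" by (auto simp: I_def)
        then have "a \<noteq> T" using gT b by auto
        from T_above[OF a(1) this] show False using gT a b by simp
      next
        case False
        then have blocks: "\<exists>i u. g a = Block i u" if "a \<in> A" for a
          using that noRef[of a] by (cases "g a") auto
        obtain z where z: "z \<in> A" using nonempty by blast
        define i where "i = pos (g z)"
        have lt: "r1 a < r1 b \<and> r2 a < r2 b" if "a \<in> A" "b \<in> A" "pos (g a) < pos (g b)" for a b
          using that blocks[of a] blocks[of b] by (intro conjI lt1 lt2) auto
        have "(\<forall>a\<in>A. pos (g a) < i) \<or> (\<forall>a\<in>A. \<not> pos (g a) < i)"
          by (rule sum_indecomposable) (use lt in auto)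
        moreover have "(\<forall>a\<in>A. pos (g a) \<le> i) \<or> (\<forall>a\<in>A. \<not> pos (g a) \<le> i)"
          by (rule sum_indecomposable) (use lt in auto)
        ultimately have eq: "pos (g a) = i" if "a \<in> A" for a
          using z that unfolding i_def by (meson antisym not_le order_refl order_less_irrefl)
        define S where "S = (if i = 0 then A - {R} else if i \<le> n then A - {B, R} else A - {B})"
        have "card A \<le> card S"
        proof (rule card_block_le[OF g])
          fix a assume a: "a \<in> A"
          then obtain u where "g a = Block i u" using blocks[of a] eq[of a] by auto
          then show "\<exists>u\<in>S. g a = Block i u" using site[OF a] by (auto simp: S_def)
        qed (use fin in \<open>auto simp: S_def\<close>)
        moreover have "S \<subset> A" using LTR B by (auto simp: S_def)
        then have "card S < card A" by (rule psubset_card_mono[OF fin])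
        ultimately show False by simp
      qed
    qed
  qed
  have odd_not_proper: "\<not> proper n c" if n: "odd n" for n c
  proof
    assume p: "proper n c"
    have emb: "\<exists>a\<in>A. \<exists>b\<in>A. free n (g a) \<and> free n (g b) \<and> c (g a) \<noteq> c (g b)"
      if "embeds A r1 r2 (Collect (site n)) (key1 n) (key2 n) g" for g
      using p that by (auto simp: proper_def)
    have "c (Link i) \<noteq> c (Link (Suc i))" if i: "i < n" for i
    proof -
      have "embeds A r1 r2 (Collect (site n)) (key1 n) (key2 n)
          (\<lambda>a. if a = B then Link i else if a = R then Link (Suc i) else Block (Suc i) a)"
        using i B R1 ne LTR by (auto simp: embeds_def not_less intro: less_imp_le dest: less_not_sym)
      from emb[OF this] i show ?thesis by (auto split: if_splits)
    qed
    then have "c (Link n) = (c (Link 0) = even n)" by (rule links_alternate) auto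
    moreover have "c (Block 0 T) \<noteq> c (Link 0)"
    proof -
      have "embeds A r1 r2 (Collect (site n)) (key1 n) (key2 n)
          (\<lambda>a. if a = R then Link 0 else Block 0 a)"
        using R1 LTR by (auto simp: embeds_def not_less intro: less_imp_le dest: less_not_sym)
      from emb[OF this] show ?thesis by (auto split: if_splits)
    qed
    moreover have "c (Block 0 T) \<noteq> c Ref"
    proof -
      have "embeds A r1 r2 (Collect (site n)) (key1 n) (key2 n)
          (\<lambda>a. if a = R then Ref else Block 0 a)"
        using R1 neq LTR
        by (auto simp: embeds_def not_less double_shift le_iff intro: less_imp_le dest: less_not_sym)
      from emb[OF this] show ?thesis by (auto split: if_splits)
    qed
    moreover have "c (Link n) \<noteq> c (Block (Suc n) T)"
    proof -
      have "embeds A r1 r2 (Collect (site n)) (key1 n) (key2 n)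
          (\<lambda>a. if a = B then Link n else Block (n + 1) a)"
        using B by (auto simp: embeds_def not_less intro: less_imp_le dest: less_not_sym)
      from emb[OF this] show ?thesis by (auto split: if_splits)
    qed
    moreover have "c Ref \<noteq> c (Block (Suc n) T)"
    proof -
      have "embeds A r1 r2 (Collect (site n)) (key1 n) (key2 n)
          (\<lambda>a. if a = B then Ref else Block (n + 1) a)"
        using B neq
        by (auto simp: embeds_def not_less double_shift le_iff intro: less_imp_le dest: less_not_sym)
      from emb[OF this] show ?thesis by (auto split: if_splits)
    qed
    ultimately show False using n by auto
  qed
  show ?thesis
    by (rule undefinable_if_parity) (use even_proper odd_not_proper in blast)+
qed

section \<open>Patterns with both kinds of cuts\<close>

lemma undefinable_flip_values:
  assumes "undefinable A r1 (\<lambda>a. - r2 a)"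
  shows "undefinable A r1 r2"
  by (rule undefinable_transp, rule undefinable_flip, rule undefinable_transp, rule assms)

context simple_pattern
begin

text \<open>\<open>z\<close> is above and to the left of \<open>Q\<close>, \<open>P\<close> below
  and to the left, so \<open>Q\<close> is an interval and has one point \<open>q\<close>. Since
  \<open>z\<close> is no corner, \<open>w\<close> lies to its left, and \<open>w\<close>,
  \<open>z\<close>, \<open>q\<close> serve as \<open>L\<close>, \<open>T\<close>,
  \<open>R\<close>.\<close>

lemma undefinable_if_cut_vertex_top_left:
  assumes cut: "sum_cut A r1 r2 z P Q" and w: "w \<in> P"
    and z1: "\<And>a. a \<in> A \<Longrightarrow> a \<noteq> z \<Longrightarrow> a \<noteq> w \<Longrightarrow> r1 z < r1 a"
    and z2: "\<And>a. a \<in> A \<Longrightarrow> a \<noteq> z \<Longrightarrow> a \<noteq> w \<Longrightarrow> r2 a < r2 z"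
  shows "undefinable A r1 r2"
proof -
  have zA: "z \<in> A" and PQ: "P \<union> Q = A - {z}" and Q0: "Q \<noteq> {}"
    and lt: "\<And>a b. a \<in> P \<Longrightarrow> b \<in> Q \<Longrightarrow> r1 a < r1 b \<and> r2 a < r2 b"
    using cut by (auto simp: sum_cut_def)
  have wA: "w \<in> A" "w \<noteq> z" "w \<notin> Q" using w PQ lt[of w w] by auto
  have QA: "a \<in> A" "a \<noteq> z" "a \<noteq> w" if "a \<in> Q" for a using that PQ wA by auto
  obtain q where q: "q \<in> Q" using Q0 by blast
  have z2': "r2 a < r2 z" if "a \<in> A" "a \<noteq> z" for a
  proof (cases "a = w")
    case True
    then show ?thesis using lt[OF w q] z2[OF QA[OF q]] by simp
  qed (use z2 that in blast)
  have wz: "r1 w < r1 z"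
  proof (rule ccontr)
    assume "\<not> r1 w < r1 z"
    moreover have "r1 w \<noteq> r1 z" using inj1 wA zA by (auto simp: inj_on_def)
    ultimately have "r1 z < r1 w" by simp
    then have "\<forall>a\<in>A - {z}. r1 z < r1 a" using z1 by blast
    then show False using no_corner[OF zA] z2' by blast
  qed
  have "card Q \<le> 1"
  proof (rule interval_trivial)
    fix p a b assume h: "p \<in> A" "p \<notin> Q" "a \<in> Q" "b \<in> Q"
    then have "p = z \<or> p \<in> P" using PQ by blast
    then show "\<not> (r1 a < r1 p \<and> r1 p < r1 b) \<and> \<not> (r2 a < r2 p \<and> r2 p < r2 b)"
      using lt[of p a] h z1[OF QA[OF h(3)]] z2[OF QA[OF h(4)]] by auto
  qed (use QA wA in auto)
  moreover have "finite Q" using QA fin by (meson finite_subset subsetI)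
  ultimately have Q: "a = q" if "a \<in> Q" for a
    using that q card_le_Suc0_iff_eq[of Q] by auto
  have inP: "a \<in> P" if "a \<in> A" "a \<noteq> z" "a \<noteq> q" for a using that PQ Q by blast
  show ?thesis
  proof (rule undefinable_if_nearly_top_left[of w z q])
    fix a assume a: "a \<in> A" "a \<noteq> q"
    then show "r1 a < r1 q" using lt[OF inP[OF a(1) _ a(2)] q] z1[OF QA[OF q]] by (cases "a = z") auto
  next
    fix a assume a: "a \<in> A" "a \<noteq> z" "a \<noteq> q"
    then show "r2 a < r2 q" using lt[OF inP[OF a] q] by simp
  qed (use wA zA QA[OF q] wz z1 z2' in auto)
qed

end

lemma sum_cut_transp: "sum_cut A r2 r1 z P Q \<longleftrightarrow> sum_cut A r1 r2 z P Q"
  by (simp add: sum_cut_def conj_commute)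

lemma sum_cut_rotate: "sum_cut A (\<lambda>a. - r1 a) (\<lambda>a. - r2 a) z Q P \<longleftrightarrow> sum_cut A r1 r2 z P Q"
  unfolding sum_cut_def by auto

text \<open>\<open>a\<close> and \<open>b\<close> form an increasing pair, while pairs across the
  skew cut are decreasing.\<close>

lemma same_side:
  assumes cut: "sum_cut A r1 r2 z P Q" and skew: "sum_cut A (\<lambda>a. - r1 a) r2 w P' Q'"
    and "a \<in> P" "b \<in> Q" "a \<noteq> w" "b \<noteq> w"
  shows "a \<in> P' \<and> b \<in> P' \<or> a \<in> Q' \<and> b \<in> Q'"
proof -
  have "a \<in> P' \<union> Q'" "b \<in> P' \<union> Q'" using assms by (auto simp: sum_cut_def)
  moreover have "r1 a < r1 b" "r2 a < r2 b" using assms by (auto simp: sum_cut_def)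
  moreover have "r1 y < r1 x \<and> r2 x < r2 y" if "x \<in> P'" "y \<in> Q'" for x y
    using skew that by (auto simp: sum_cut_def)
  ultimately show ?thesis by (metis UnE less_asym)
qed

context simple_pattern
begin

text \<open>By \<open>same_side\<close>, each point of \<open>P\<close> other than \<open>w\<close>
  is on the same side of the skew cut as each point of \<open>Q\<close>. So all points but
  \<open>z\<close> and \<open>w\<close> are on one side, and the other side is \<open>{z}\<close>:
  apart from \<open>w\<close>, \<open>z\<close> is an upper left or lower right corner. The latter
  is transposed into the former.\<close>

lemma undefinable_if_two_cuts_lower:
  assumes cut: "sum_cut A r1 r2 z P Q" and skew: "sum_cut A (\<lambda>a. - r1 a) r2 w P' Q'"
    and w: "w \<in> P" "P \<noteq> {w}"
  shows "undefinable A r1 r2"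
proof -
  have A: "P \<union> Q = A - {z}" "P' \<union> Q' = A - {w}" "z \<in> A" "Q \<noteq> {}" "P' \<noteq> {}" "Q' \<noteq> {}"
    using cut skew by (auto simp: sum_cut_def)
  have disj: "P \<inter> Q = {}" "P' \<inter> Q' = {}" using cut skew by (auto simp: sum_cut_def)
  obtain p where p: "p \<in> P" "p \<noteq> w" using w by blast
  obtain q where q: "q \<in> Q" using A by blast
  have Qw: "b \<noteq> w" if "b \<in> Q" for b using that w disj by blast
  have zw: "z \<noteq> w" using w A by blast
  have side: "a \<in> P' \<and> b \<in> P' \<or> a \<in> Q' \<and> b \<in> Q'" if "a \<in> P" "b \<in> Q" "a \<noteq> w" for a b
    using same_side[OF cut skew that(1,2,3) Qw[OF that(2)]] .
  have rest: "a \<in> P \<or> a \<in> Q" if "a \<in> A" "a \<noteq> z" for a using that A by blast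
  have lt: "r1 y < r1 x \<and> r2 x < r2 y" if "x \<in> P'" "y \<in> Q'" for x y
    using skew that by (auto simp: sum_cut_def)
  have rest': "y \<in> A \<and> y \<noteq> w" if "y \<in> P' \<or> y \<in> Q'" for y using that A(2) by blast
  have "q \<in> P' \<or> q \<in> Q'" using side[OF p(1) q p(2)] by blast
  then show ?thesis
  proof
    assume "q \<in> P'"
    then have "q \<notin> Q'" using disj by blast
    then have "p \<in> P'" "p \<notin> Q'" using side[OF p(1) q p(2)] disj by blast+
    have all: "a \<in> P'" if "a \<in> A" "a \<noteq> z" "a \<noteq> w" for a
      using rest[OF that(1,2)] side[of a q] side[of p a] that(3) p q \<open>q \<notin> Q'\<close> \<open>p \<notin> Q'\<close> by blast
    obtain y where y: "y \<in> Q'" using A by blast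
    then have "y = z" using all[of y] rest'[of y] disj by blast
    then have "r1 z < r1 a \<and> r2 a < r2 z" if "a \<in> A" "a \<noteq> z" "a \<noteq> w" for a
      using lt[OF all[OF that]] y by blast
    then show ?thesis
      by (intro undefinable_if_cut_vertex_top_left[OF cut w(1)]) blast+
  next
    assume "q \<in> Q'"
    then have "q \<notin> P'" using disj by blast
    then have "p \<in> Q'" "p \<notin> P'" using side[OF p(1) q p(2)] disj by blast+
    have all: "a \<in> Q'" if "a \<in> A" "a \<noteq> z" "a \<noteq> w" for a
      using rest[OF that(1,2)] side[of a q] side[of p a] that(3) p q \<open>q \<notin> P'\<close> \<open>p \<notin> P'\<close> by blast
    obtain y where y: "y \<in> P'" using A by blast
    then have "y = z" using all[of y] rest'[of y] disj by blast
    then have *: "r2 z < r2 a \<and> r1 a < r1 z" if "a \<in> A" "a \<noteq> z" "a \<noteq> w" for a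
      using lt[OF _ all[OF that]] y by blast
    have cut': "sum_cut A r2 r1 z P Q" using cut by (simp only: sum_cut_transp)
    show ?thesis
      by (rule undefinable_transp)
        (rule simple_pattern.undefinable_if_cut_vertex_top_left[OF
            simple_pattern_transp[OF simple_pattern_axioms] cut' w(1)], (use * in blast)+)
  qed
qed

lemma undefinable_if_two_cuts_proper:
  assumes cut: "sum_cut A r1 r2 z P Q" and skew: "sum_cut A (\<lambda>a. - r1 a) r2 w P' Q'"
    and w: "w \<in> P \<and> P \<noteq> {w} \<or> w \<in> Q \<and> Q \<noteq> {w}"
  shows "undefinable A r1 r2"
  using w
proof
  assume "w \<in> P \<and> P \<noteq> {w}"
  then show ?thesis using undefinable_if_two_cuts_lower[OF cut skew] by blast
next
  assume w: "w \<in> Q \<and> Q \<noteq> {w}"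
  \<comment> \<open>A half turn of the pattern exchanges \<open>P\<close> with \<open>Q\<close> and
    \<open>P'\<close> with \<open>Q'\<close>.\<close>
  have simple: "simple_pattern A (\<lambda>a. - r1 a) (\<lambda>a. - r2 a)"
    using simple_pattern_flip[OF simple_pattern_transp[OF simple_pattern_flip[OF
          simple_pattern_transp[OF simple_pattern_axioms]]]] .
  have cut': "sum_cut A (\<lambda>a. - r1 a) (\<lambda>a. - r2 a) z Q P"
    using cut by (simp only: sum_cut_rotate)
  have skew': "sum_cut A (\<lambda>a. - (- r1 a)) (\<lambda>a. - r2 a) w Q' P'"
    using skew by (simp only: sum_cut_rotate)
  have "undefinable A (\<lambda>a. - r1 a) (\<lambda>a. - r2 a)"
    by (rule simple_pattern.undefinable_if_two_cuts_lower[OF simple cut' skew']) (use w in auto)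
  then show ?thesis by (rule undefinable_flip_values[OF undefinable_flip])
qed

lemma undefinable_if_two_cuts:
  assumes cut: "sum_cut A r1 r2 z P Q" and skew: "sum_cut A (\<lambda>a. - r1 a) r2 w P' Q'"
  shows "undefinable A r1 r2"
proof -
  have A: "P \<union> Q = A - {z}" "P' \<union> Q' = A - {w}" "z \<in> A" "w \<in> A"
    "P \<noteq> {}" "Q \<noteq> {}" "P' \<noteq> {}" "Q' \<noteq> {}"
    using cut skew by (auto simp: sum_cut_def)
  have disj: "P \<inter> Q = {}" "P' \<inter> Q' = {}" using cut skew by (auto simp: sum_cut_def)
  \<comment> \<open>With a common vertex, \<open>same_side\<close> would leave one side of the skew
    cut empty.\<close>
  have zw: "z \<noteq> w"
  proof
    assume "z = w"
    have "a \<in> P' \<and> b \<in> P' \<or> a \<in> Q' \<and> b \<in> Q'" if "a \<in> P" "b \<in> Q" for a b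
      by (rule same_side[OF cut skew that]) (use that A \<open>z = w\<close> in auto)
    then have "P \<union> Q \<subseteq> P' \<or> P \<union> Q \<subseteq> Q'" using A(5,6) disj(2) by blast
    then show False using A \<open>z = w\<close> disj(2) by blast
  qed
  \<comment> \<open>Reversal exchanges the two cuts, so the second case reduces to the first. In the
    third each vertex is alone on a side of the other cut; then both lie outside the range of the
    remaining points in both coordinates, and these form an interval.\<close>
  consider "w \<in> P \<and> P \<noteq> {w} \<or> w \<in> Q \<and> Q \<noteq> {w}" | "z \<in> P' \<and> P' \<noteq> {z} \<or> z \<in> Q' \<and> Q' \<noteq> {z}"
    | "P = {w} \<or> Q = {w}" "P' = {z} \<or> Q' = {z}"
    using A zw by blast
  then show ?thesis
  proof cases
    case 1
    then show ?thesis by (rule undefinable_if_two_cuts_proper[OF cut skew])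
  next
    case 2
    have cut': "sum_cut A (\<lambda>a. - (- r1 a)) r2 z P Q" using cut by simp
    show ?thesis
      by (rule undefinable_flip, rule simple_pattern.undefinable_if_two_cuts_proper[OF
            simple_pattern_flip[OF simple_pattern_axioms] skew cut' 2])
  next
    case 3
    have w: "(\<forall>a\<in>A - {z, w}. r1 w < r1 a \<and> r2 w < r2 a) \<or> (\<forall>a\<in>A - {z, w}. r1 a < r1 w \<and> r2 a < r2 w)"
      using cut 3(1) unfolding sum_cut_def by blast
    have z: "(\<forall>a\<in>A - {z, w}. r1 a < r1 z \<and> r2 z < r2 a) \<or> (\<forall>a\<in>A - {z, w}. r1 z < r1 a \<and> r2 a < r2 z)"
      using skew 3(2) unfolding sum_cut_def neg_less_iff_less by blast
    have "card (A - {z, w}) \<le> 1"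
    proof (rule interval_trivial)
      fix p a b assume h: "p \<in> A" "p \<notin> A - {z, w}" "a \<in> A - {z, w}" "b \<in> A - {z, w}"
      then consider "p = z" | "p = w" by blast
      then show "\<not> (r1 a < r1 p \<and> r1 p < r1 b) \<and> \<not> (r2 a < r2 p \<and> r2 p < r2 b)"
        by cases (use z w h(3,4) in \<open>meson less_asym\<close>)+
    qed (use A in auto)
    moreover have "card (A - {z, w}) + 2 = card A"
      using A zw fin card4 by (simp add: card_Diff_subset)
    ultimately show ?thesis using card4 by simp
  qed
qed

lemma undefinable_simple_pattern: "undefinable A r1 r2"
proof -
  consider "\<And>z P Q. \<not> sum_cut A r1 r2 z P Q" | "\<And>w P Q. \<not> sum_cut A (\<lambda>a. - r1 a) r2 w P Q"
    | z P Q w P' Q' where "sum_cut A r1 r2 z P Q" "sum_cut A (\<lambda>a. - r1 a) r2 w P' Q'"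
    by blast
  then show ?thesis
  proof cases
    case 1
    then show ?thesis by (rule undefinable_if_no_sum_cut)
  next
    case 2
    show ?thesis
      by (rule undefinable_flip)
        (rule simple_pattern.undefinable_if_no_sum_cut[OF simple_pattern_flip[OF simple_pattern_axioms] 2])
  next
    case 3
    then show ?thesis by (rule undefinable_if_two_cuts)
  qed
qed

end

theorem theorem2:
  fixes \<alpha> :: "nat list"
  assumes "simple_perm \<alpha>" and "length \<alpha> \<ge> 4"
  shows "\<not> fo_definable_TOTO (perm_merge (Av \<alpha>) (Av \<alpha>))"
proof -
  have "simple_pattern (diagram \<alpha>) pos_rank val_rank"
  proof
    show "inj_on pos_rank (diagram \<alpha>)" "inj_on val_rank (diagram \<alpha>)"
      using inj_on_fst_diagram[of \<alpha>] inj_on_snd_diagram[of \<alpha>] assms(1)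
      by (auto simp: inj_on_def simple_perm_def)
  next
    fix X assume X: "X \<subseteq> diagram \<alpha>" "2 \<le> card X" "X \<noteq> diagram \<alpha>"
    obtain p a b where "p \<in> diagram \<alpha> - X" "a \<in> X" "b \<in> X"
      "(fst a < fst p \<and> fst p < fst b) \<or> (snd a < snd p \<and> snd p < snd b)"
      by (rule simple_perm_diagram_split[OF assms(1) X])
    then show "\<exists>p\<in>diagram \<alpha> - X. \<exists>a\<in>X. \<exists>b\<in>X.
        pos_rank a < pos_rank p \<and> pos_rank p < pos_rank b \<or> val_rank a < val_rank p \<and> val_rank p < val_rank b"
      unfolding of_nat_less_iff by blast
  qed (use assms(2) finite_diagram card_diagram in auto)
  then show ?thesis
    by (rule undefinable_imp_not_fo_definable[OF simple_pattern.undefinable_simple_pattern])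
qed

end
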